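(* Consider the linearized swing dynamics $\bm M\dot{\bm\omega}+\bm D\bm\omega=\delta\bm P(t)-\mathbb{L}\,\delta\bm\theta$, $\bm\omega=\delta\dot{\bm\theta}$, $t\ge0$, with $\delta\bm\theta(0)=\bm\omega(0)=0$ and constant damping-to-inertia ratio $d_i/m_i=\gamma>0$ for all $i$. Let the disturbance $\delta\bm P(t)$ be a noise acting on a set $N_n\subseteq\{1,\dots,n\}$ of network nodes (so $\delta P_i\equiv0$ for $i\notin N_n$), Gaussian, with $\overline{\delta P_i(t)}=0$ and $$\overline{\delta P_i(t)\,\delta P_j(t')}=\delta_{ij}\,\delta P_{0i}^2\,\exp\!\big[-|t-t'|/\tau_0\big],\qquad i,j\in N_n .$$ Let $\overline{\mathcal{P}^\infty}=\lim_{T\to\infty}\overline{\mathcal{P}(T)}$ be the noise-averaged primary control effort. In the limit of long noise correlation time, $\tau_0\gg\gamma^{-1},(\lambda_\alpha^D)^{-1}$ for all $\alpha\ge2$, one has to leading order in $\tau_0^{-1}$ $$\overline{\mathcal{P}^\infty}=\tau_0^{-1}\sum_{\alpha\ge2}\frac{\sum_{i\in N_n}\delta P_{0i}^2\,(u_{\alpha,i}^D)^2\,d_i^{-1}}{\lambda_\alpha^D},$$ i.e., with all other parameters fixed, the difference of the two sides is $o(\tau_0^{-1})$ as $\tau_0\to\infty$.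
   Context: Setting: a power network with nodes $i=1,\dots,n$, symmetric line susceptances $b_{ij}=b_{ji}\ge0$, inertia $m_i>0$, damping $d_i>0$, $\bm M=\mathrm{diag}\{m_i\}$, $\bm D=\mathrm{diag}\{d_i\}$. $\bm\theta^{(0)}$ is a stable synchronous stationary solution of $m_i\dot\omega_i+d_i\omega_i=P_i-\sum_j b_{ij}\sin(\theta_i-\theta_j)$, $\omega_i=\dot\theta_i$. The weighted Laplacian $\mathbb{L}$ has entries $\mathbb{L}_{ij}=-b_{ij}\cos(\theta_i^{(0)}-\theta_j^{(0)})$ for $i\neq j$ and $\mathbb{L}_{ii}=\sum_k b_{ik}\cos(\theta_i^{(0)}-\theta_k^{(0)})$ (sum over $k\neq i$). Since the synchronous state is stable, $\mathbb{L}$ is assumed symmetric positive semidefinite with a simple zero eigenvalue, with eigenvector $(1,\dots,1)/\sqrt n$. Set $\mathbb{L}^D=\bm D^{-1/2}\mathbb{L}\bm D^{-1/2}$, with orthonormal real eigenvectors $\bm u_1^D,\dots,\bm u_n^D$ (components $u_{\alpha,i}^D$) and eigenvalues $\lambda_1^D=0$, $\lambda_\alpha^D>0$ for $\alpha\ge2$; here $\bm u_1^D=(\sqrt{d_1},\dots,\sqrt{d_n})/\sqrt{\sum_i d_i}$. The performance metric (primary control effort) is $$\mathcal{P}(T)=T^{-1}\int_0^T(\bm\omega^\top-\overline{\bm\omega}^\top)\,\bm D\,(\bm\omega-\overline{\bm\omega})\,\mathrm{d}t,$$ where $\overline{\bm\omega}^\top=(\dot\Delta,\dots,\dot\Delta)$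 with $\dot\Delta(t)=\sum_i d_i\omega_i(t)/\sum_i d_i$ (here the bar on $\bm\omega$ denotes this network average). An overline on any other quantity denotes the statistical average (expectation) over the noise ensemble. *)

theory Defs
  imports "HOL-Probability.Probability" "HOL-Library.Landau_Symbols"
begin

definition diag_matrix :: "real ^ 'n \<Rightarrow> real ^ 'n ^ 'n" where
  "diag_matrix v = (\<chi> i j. if i = j then v $ i else 0)"

definition swing_solution ::
  "real ^ 'n ^ 'n \<Rightarrow> real ^ 'n \<Rightarrow> real ^ 'n \<Rightarrow> real ^ 'n \<Rightarrow> (real \<Rightarrow> real ^ 'n) \<Rightarrow> bool" where
  "swing_solution b m d P \<theta> \<longleftrightarrow>
     (\<exists>\<omega> a. \<forall>t.
        (\<theta> has_vector_derivative \<omega> t) (at t) \<and> (\<omega> has_vector_derivative a t) (at t) \<and>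
        (\<forall>i. m $ i * a t $ i + d $ i * \<omega> t $ i
              = P $ i - (\<Sum>j\<in>UNIV. b $ i $ j * sin (\<theta> t $ i - \<theta> t $ j))))"

text \<open>A synchronous stationary solution: all nodes rotate at one common frequency
  (which is \<open>0\<close> in the co-rotating frame), with constant angle differences.\<close>

definition synchronous_state ::
  "real ^ 'n ^ 'n \<Rightarrow> real ^ 'n \<Rightarrow> real ^ 'n \<Rightarrow> real ^ 'n \<Rightarrow> real ^ 'n \<Rightarrow> bool" where
  "synchronous_state b m d P \<theta>0 \<longleftrightarrow>
     (\<exists>\<Omega>. swing_solution b m d P (\<lambda>t. \<chi> i. \<theta>0 $ i + \<Omega> * t))"

definition weighted_laplacian :: "real ^ 'n ^ 'n \<Rightarrow> real ^ 'n \<Rightarrow> real ^ 'n ^ 'n" where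
  "weighted_laplacian b \<theta>0 =
     (\<chi> i j. if i = j then \<Sum>k\<in>UNIV - {i}. b $ i $ k * cos (\<theta>0 $ i - \<theta>0 $ k)
             else - b $ i $ j * cos (\<theta>0 $ i - \<theta>0 $ j))"

text \<open>For a symmetric matrix the geometric multiplicity of an eigenvalue is its multiplicity,
  so simplicity of the eigenvalue \<open>0\<close> is one-dimensionality of its eigenspace.\<close>

definition stable_laplacian :: "real ^ 'n ^ 'n \<Rightarrow> bool" where
  "stable_laplacian L \<longleftrightarrow>
     transpose L = L \<and> (\<forall>x. 0 \<le> x \<bullet> (L *v x)) \<and>
     dim {x. L *v x = 0 *\<^sub>R x} = 1 \<and>
     L *v (\<chi> i. 1 / sqrt (real CARD('n))) = 0"

definition damped_laplacian :: "real ^ 'n \<Rightarrow> real ^ 'n ^ 'n \<Rightarrow> real ^ 'n ^ 'n" where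
  "damped_laplacian d L =
     diag_matrix (\<chi> i. 1 / sqrt (d $ i)) ** L ** diag_matrix (\<chi> i. 1 / sqrt (d $ i))"

definition orthonormal_eigenbasis ::
  "real ^ 'n ^ 'n \<Rightarrow> (nat \<Rightarrow> real ^ 'n) \<Rightarrow> (nat \<Rightarrow> real) \<Rightarrow> bool" where
  "orthonormal_eigenbasis A u l \<longleftrightarrow>
     (\<forall>\<alpha>\<in>{1..CARD('n)}. \<forall>\<beta>\<in>{1..CARD('n)}. u \<alpha> \<bullet> u \<beta> = (if \<alpha> = \<beta> then 1 else 0)) \<and>
     (\<forall>\<alpha>\<in>{1..CARD('n)}. A *v u \<alpha> = l \<alpha> *\<^sub>R u \<alpha>)"

text \<open>Classical solution of the linearized dynamics on the half-line, started at rest.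
  The derivative at \<open>t = 0\<close> is one-sided.\<close>

definition linearized_swing_solution ::
  "real ^ 'n \<Rightarrow> real ^ 'n \<Rightarrow> real ^ 'n ^ 'n \<Rightarrow>
   (real \<Rightarrow> real ^ 'n) \<Rightarrow> (real \<Rightarrow> real ^ 'n) \<Rightarrow> (real \<Rightarrow> real ^ 'n) \<Rightarrow> bool" where
  "linearized_swing_solution m d L \<delta>P \<delta>\<theta> \<omega> \<longleftrightarrow>
     \<delta>\<theta> 0 = 0 \<and> \<omega> 0 = 0 \<and>
     (\<forall>t\<ge>0. (\<delta>\<theta> has_vector_derivative \<omega> t) (at t within {0..}) \<and>
        (\<exists>a. (\<omega> has_vector_derivative a) (at t within {0..}) \<and>
             diag_matrix m *v a + diag_matrix d *v \<omega> t = \<delta>P t - L *v \<delta>\<theta> t))"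

text \<open>Joint measurability in time and sample point, on the time half-line.\<close>

definition measurable_process ::
  "'w measure \<Rightarrow> (real \<Rightarrow> 'w \<Rightarrow> 'b::topological_space) \<Rightarrow> bool" where
  "measurable_process M X \<longleftrightarrow>
     (\<lambda>(t, w). X t w) \<in> borel_measurable (restrict_space borel {0..} \<Otimes>\<^sub>M M)"

text \<open>Constants count as (degenerate) Gaussian variables.\<close>

definition gaussian_variable :: "'w measure \<Rightarrow> ('w \<Rightarrow> real) \<Rightarrow> bool" where
  "gaussian_variable M X \<longleftrightarrow> X \<in> borel_measurable M \<and>
     (\<exists>\<mu>. (AE w in M. X w = \<mu>) \<or>
          (\<exists>\<sigma>>0. distributed M lborel X (normal_density \<mu> \<sigma>)))"

definition gaussian_process :: "'w measure \<Rightarrow> 'i set \<Rightarrow> ('i \<Rightarrow> 'w \<Rightarrow> real) \<Rightarrow> bool" where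
  "gaussian_process M I X \<longleftrightarrow>
     (\<forall>F c. finite F \<and> F \<subseteq> I \<longrightarrow> gaussian_variable M (\<lambda>w. \<Sum>x\<in>F. c x * X x w))"

text \<open>Noise on the nodes in \<open>N\<close>, uncorrelated between nodes, with standard deviations
  \<open>\<delta>P0\<close> and correlation time \<open>\<tau>\<close>.\<close>

definition correlated_noise ::
  "'w measure \<Rightarrow> 'n set \<Rightarrow> real ^ 'n \<Rightarrow> real \<Rightarrow> (real \<Rightarrow> 'w \<Rightarrow> real ^ 'n) \<Rightarrow> bool" where
  "correlated_noise M N \<delta>P0 \<tau> \<delta>P \<longleftrightarrow>
     measurable_process M \<delta>P \<and>
     (\<forall>i. i \<notin> N \<longrightarrow> (\<forall>t\<ge>0. \<forall>w\<in>space M. \<delta>P t w $ i = 0)) \<and>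
     gaussian_process M ({0..} \<times> N) (\<lambda>(t, i) w. \<delta>P t w $ i) \<and>
     (\<forall>i\<in>N. \<forall>t\<ge>0. (LINT w|M. \<delta>P t w $ i) = 0) \<and>
     (\<forall>i\<in>N. \<forall>j\<in>N. \<forall>t\<ge>0. \<forall>t'\<ge>0.
        (LINT w|M. \<delta>P t w $ i * \<delta>P t' w $ j)
          = (if i = j then (\<delta>P0 $ i)\<^sup>2 * exp (- \<bar>t - t'\<bar> / \<tau>) else 0))"

definition network_average :: "real ^ 'n \<Rightarrow> real ^ 'n \<Rightarrow> real ^ 'n" where
  "network_average d v = (\<chi> j. (\<Sum>i\<in>UNIV. d $ i * v $ i) / (\<Sum>i\<in>UNIV. d $ i))"

definition control_effort :: "real ^ 'n \<Rightarrow> (real \<Rightarrow> real ^ 'n) \<Rightarrow> real \<Rightarrow> real" where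
  "control_effort d \<omega> T = (1 / T) *
     (LBINT t:{0..T}. (\<omega> t - network_average d (\<omega> t)) \<bullet>
        (diag_matrix d *v (\<omega> t - network_average d (\<omega> t))))"

definition mean_control_effort ::
  "'w measure \<Rightarrow> real ^ 'n \<Rightarrow> (real \<Rightarrow> 'w \<Rightarrow> real ^ 'n) \<Rightarrow> real \<Rightarrow> real" where
  "mean_control_effort M d \<omega> T = (LINT w|M. control_effort d (\<lambda>t. \<omega> t w) T)"

definition mean_control_effort_inf ::
  "'w measure \<Rightarrow> real ^ 'n \<Rightarrow> (real \<Rightarrow> 'w \<Rightarrow> real ^ 'n) \<Rightarrow> real" where
  "mean_control_effort_inf M d \<omega> = Lim at_top (\<lambda>T. mean_control_effort M d \<omega> T)"

end

theory Submission
  imports Defs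
begin

text \<open>
  In the eigenbasis of the damped Laplacian the dynamics decouples into damped oscillators
  \<open>c'' + \<gamma> c' + \<gamma> \<lambda> c = \<gamma> f\<close>, driven by noise of covariance \<open>S exp (- k |t - s|)\<close> with
  \<open>k = 1 / \<tau>\<close>, and the control effort is the time average of \<open>\<Sum>\<alpha>\<ge>2. (c\<^sub>\<alpha>')\<^sup>2\<close>.  Path-wise energy
  balance turns the mean of \<open>(c')\<^sup>2\<close> into the mean of \<open>E [c'(t) f(t)]\<close>, up to boundary terms that
  a Lyapunov function keeps bounded.  For fixed \<open>s\<close> the correlation \<open>q(t) = E [c(t) f(s)]\<close> solves
  the same oscillator equation with forcing \<open>\<gamma> S exp (- k (s - t))\<close>; its exponential particular
  solution gives \<open>E [c'(t) f(t)] \<rightarrow> k \<gamma> S / (k\<^sup>2 + \<gamma> k + \<gamma> \<lambda>)\<close>, which is \<open>k S / \<lambda>\<close> to leading order.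
\<close>

section \<open>The damped oscillator\<close>

text \<open>The oscillator is never solved explicitly: a formula would split by the sign of
  \<open>\<gamma> - 4 * l\<close> (over- or underdamped), whereas energy arguments treat all cases
  at once. Sample paths of the noise are controlled only through joint measurability, second moments
  and the path-wise equation. Path-wise identities therefore come from the fundamental theorem for
  the gauge integral and become Lebesgue identities off a null set, where Fubini makes the
  integrands integrable. Expectations are not differentiated directly either: the correlation
  equations are first derived in integrated form, and continuity then yields the derivatives. The
  correlation with the force at time \<open>s\<close> is followed only for \<open>t \<le> s\<close>,
  where \<open>\<bar>t - s\<bar> = s - t\<close> and the forcing is a single exponential. The
  endpoint \<open>t = s\<close> is the wanted diagonal value. At \<open>t = 0\<close> the particular
  solution already has size \<open>exp (- k * s)\<close>, and the energy of the difference cannot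
  grow, so the error at \<open>t = s\<close> has this size too. The Lyapunov decay rate serves a
  different end: moments bounded uniformly in time.\<close>

lemma oscillator_lyapunov_coeffs:
  fixes \<gamma> l :: real
  assumes "0 < \<gamma>" "0 < l"
  obtains e K :: real where "0 < e" "0 < K"
    "\<And>c z. (z\<^sup>2 + \<gamma> * l * c\<^sup>2) / 4 \<le> (z\<^sup>2 + \<gamma> * l * c\<^sup>2) / 2 + e * c * z"
    "\<And>c z f. z * (\<gamma> * f - \<gamma> * z - \<gamma> * l * c) + \<gamma> * l * c * z
        + e * (z * z + c * (\<gamma> * f - \<gamma> * z - \<gamma> * l * c))
      \<le> - (e / 2) * ((z\<^sup>2 + \<gamma> * l * c\<^sup>2) / 2 + e * c * z) + K * f\<^sup>2"
proof -
  \<comment> \<open>The plain energy dissipates only through \<open>z\<close>; the cross term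
    \<open>e * c * z\<close> adds dissipation in \<open>c\<close>. The bound
    \<open>sqrt (\<gamma> * l) / 2\<close> keeps that term below half of the energy,
    \<open>\<gamma> / 4\<close> lets the damping absorb \<open>e * z\<^sup>2\<close>, and
    \<open>l / 4\<close> lets it absorb what remains of \<open>e * \<gamma> * c * z\<close>.\<close>
  define e where "e = min (min (\<gamma> / 4) (l / 4)) (sqrt (\<gamma> * l) / 2)"
  \<comment> \<open>Sum of the coefficients of \<open>f\<^sup>2\<close> left by the Young splits of
    \<open>z * f\<close> and of \<open>c * f\<close>.\<close>
  define K where "K = \<gamma> + e * \<gamma> / l"
  have e: "0 < e" "e \<le> \<gamma> / 4" "e \<le> l / 4" "e \<le> sqrt (\<gamma> * l) / 2"
    using assms by (auto simp: e_def)
  have e2: "e\<^sup>2 \<le> \<gamma> * l / 4"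
  proof -
    have "e\<^sup>2 \<le> (sqrt (\<gamma> * l) / 2)\<^sup>2" using e by (intro power_mono) auto
    then show ?thesis using assms by (simp add: power_divide)
  qed
  have ecz: "\<bar>e * c * z\<bar> \<le> (z\<^sup>2 + \<gamma> * l * c\<^sup>2) / 4" for c z
  proof -
    have "0 \<le> (z / 2 - e * c)\<^sup>2" "0 \<le> (z / 2 + e * c)\<^sup>2" by auto
    then have "\<bar>e * c * z\<bar> \<le> z\<^sup>2 / 4 + e\<^sup>2 * c\<^sup>2" by (simp add: power2_eq_square algebra_simps abs_if)
    also have "e\<^sup>2 * c\<^sup>2 \<le> (\<gamma> * l / 4) * c\<^sup>2" using e2 by (intro mult_right_mono) auto
    finally show ?thesis by simp
  qed
  show ?thesis
  proof (rule that[of e K])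
    show "0 < e" by fact
    show "0 < K" using assms e by (simp add: K_def add_pos_pos)
    show "(z\<^sup>2 + \<gamma> * l * c\<^sup>2) / 4 \<le> (z\<^sup>2 + \<gamma> * l * c\<^sup>2) / 2 + e * c * z" for c z
      using ecz[of c z] by argo
    fix c z f :: real
    have 1: "\<gamma> * (z * f) \<le> \<gamma> * (z\<^sup>2 / 4 + f\<^sup>2)"
    proof -
      have "0 \<le> (z / 2 - f)\<^sup>2" by simp
      then show ?thesis using assms by (intro mult_left_mono) (auto simp: power2_eq_square algebra_simps)
    qed
    have aux: "c * y \<le> l * c\<^sup>2 / 4 + y\<^sup>2 / l" for y
    proof -
      have "0 \<le> (l * c / 2 - y)\<^sup>2 / l" using assms by simp
      also have "(l * c / 2 - y)\<^sup>2 / l = l * c\<^sup>2 / 4 + y\<^sup>2 / l - c * y"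
        using assms by (simp add: power2_eq_square field_simps)
      finally show ?thesis by simp
    qed
    have eg: "0 \<le> e * \<gamma>" using e assms by simp
    have 2: "e * \<gamma> * (c * f) \<le> e * \<gamma> * (l * c\<^sup>2 / 4 + f\<^sup>2 / l)"
      by (rule mult_left_mono[OF aux eg])
    have 3: "e * \<gamma> * (c * - z) \<le> e * \<gamma> * (l * c\<^sup>2 / 4 + z\<^sup>2 / l)"
      using mult_left_mono[OF aux[of "- z"] eg] by simp
    have 4: "e * \<gamma> * (z\<^sup>2 / l) \<le> \<gamma> / 4 * z\<^sup>2"
    proof -
      have "e / l * (\<gamma> * z\<^sup>2) \<le> 1 / 4 * (\<gamma> * z\<^sup>2)"
        using e assms by (intro mult_right_mono) (auto simp: field_simps)
      then show ?thesis by (simp add: field_simps)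
    qed
    have 5: "e * z\<^sup>2 \<le> \<gamma> / 4 * z\<^sup>2" using e by (intro mult_right_mono) auto
    have 6: "(e / 2) * ((z\<^sup>2 + \<gamma> * l * c\<^sup>2) / 2 + e * c * z) \<le> (e / 2) * (z\<^sup>2 + \<gamma> * l * c\<^sup>2)"
    proof (rule mult_left_mono)
      have "0 \<le> z\<^sup>2 + \<gamma> * l * c\<^sup>2" using assms by simp
      then show "(z\<^sup>2 + \<gamma> * l * c\<^sup>2) / 2 + e * c * z \<le> z\<^sup>2 + \<gamma> * l * c\<^sup>2"
        using ecz[of c z] by argo
    qed (use e in simp)
    have "z * (\<gamma> * f - \<gamma> * z - \<gamma> * l * c) + \<gamma> * l * c * z
        + e * (z * z + c * (\<gamma> * f - \<gamma> * z - \<gamma> * l * c))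
      = \<gamma> * (z * f) - \<gamma> * z\<^sup>2 + e * z\<^sup>2 + e * \<gamma> * (c * f) + e * \<gamma> * (c * - z) - e * (\<gamma> * l * c\<^sup>2)"
      by (simp add: power2_eq_square algebra_simps)
    \<comment> \<open>Budget: three quarters of the damping \<open>\<gamma> * z\<^sup>2\<close> go
      to facts 1, 4 and 5, and half of \<open>e * \<gamma> * l * c\<^sup>2\<close> goes to facts 2
      and 3.\<close>
    also have "\<dots> \<le> - (\<gamma> / 4 * z\<^sup>2) - e / 2 * (\<gamma> * l * c\<^sup>2) + K * f\<^sup>2"
    proof -
      have "\<gamma> * (z * f) \<le> \<gamma> / 4 * z\<^sup>2 + \<gamma> * f\<^sup>2" using 1 by (simp add: algebra_simps)
      moreover have "e * \<gamma> * (c * f) \<le> e * (\<gamma> * l * c\<^sup>2) / 4 + e * \<gamma> * (f\<^sup>2 / l)"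
        using 2 by (simp add: algebra_simps)
      moreover have "e * \<gamma> * (c * - z) \<le> e * (\<gamma> * l * c\<^sup>2) / 4 + e * \<gamma> * (z\<^sup>2 / l)"
        using 3 by (simp add: algebra_simps)
      moreover have "K * f\<^sup>2 = \<gamma> * f\<^sup>2 + e * \<gamma> * (f\<^sup>2 / l)" by (simp add: K_def algebra_simps)
      ultimately show ?thesis using 4 5 by argo
    qed
    also have "\<dots> \<le> - (e / 2) * (z\<^sup>2 + \<gamma> * l * c\<^sup>2) + K * f\<^sup>2"
    proof -
      have "e / 2 * z\<^sup>2 \<le> \<gamma> / 4 * z\<^sup>2" using e by (intro mult_right_mono) auto
      then show ?thesis by (simp add: algebra_simps)
    qed
    also have "\<dots> \<le> - (e / 2) * ((z\<^sup>2 + \<gamma> * l * c\<^sup>2) / 2 + e * c * z) + K * f\<^sup>2"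
      using 6 by simp
    finally show "z * (\<gamma> * f - \<gamma> * z - \<gamma> * l * c) + \<gamma> * l * c * z
        + e * (z * z + c * (\<gamma> * f - \<gamma> * z - \<gamma> * l * c))
      \<le> - (e / 2) * ((z\<^sup>2 + \<gamma> * l * c\<^sup>2) / 2 + e * c * z) + K * f\<^sup>2" .
  qed
qed

text \<open>Bridge between the Lebesgue integrals needed for Fubini and the gauge integrals
  delivered by the fundamental theorem of calculus; uniqueness of the latter then identifies the
  two.\<close>

lemma has_integral_set_lborel:
  fixes f :: "'a::euclidean_space \<Rightarrow> 'b::euclidean_space"
  assumes "set_integrable lborel S f"
  shows "(f has_integral (LINT x:S|lborel. f x)) S"
  using set_borel_integral_eq_integral[OF assms] by (simp add: has_integral_integral)

text \<open>Gronwall argument in integrated form: the weight \<open>exp (- r * (T - t))\<close>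
  turns the differential inequality for the Lyapunov function into a bound by the discounted past
  forcing. The constants depend on \<gamma> and \<open>l\<close> alone, not on the path or on
  \<open>T\<close>, so expectations can be taken afterwards.\<close>

lemma oscillator_bound:
  fixes \<gamma> l :: real
  assumes "0 < \<gamma>" "0 < l"
  obtains r K :: real where "0 < r" "0 < K"
    "\<And>c z f T. \<lbrakk>0 \<le> T; c 0 = 0; z 0 = 0;
        \<And>t. 0 \<le> t \<Longrightarrow> (c has_real_derivative z t) (at t within {0..});
        \<And>t. 0 \<le> t \<Longrightarrow> (z has_real_derivative \<gamma> * f t - \<gamma> * z t - \<gamma> * l * c t) (at t within {0..});
        set_integrable lborel {0..T} (\<lambda>t. exp (- r * (T - t)) * (f t)\<^sup>2)\<rbrakk>
      \<Longrightarrow> (z T)\<^sup>2 + \<gamma> * l * (c T)\<^sup>2 \<le> K * (LBINT t:{0..T}. exp (- r * (T - t)) * (f t)\<^sup>2)"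
proof -
  obtain e K where e: "0 < e" "0 < K"
    and low: "\<And>c z. (z\<^sup>2 + \<gamma> * l * c\<^sup>2) / 4 \<le> (z\<^sup>2 + \<gamma> * l * c\<^sup>2) / 2 + e * c * z"
    and der: "\<And>c z f. z * (\<gamma> * f - \<gamma> * z - \<gamma> * l * c) + \<gamma> * l * c * z
        + e * (z * z + c * (\<gamma> * f - \<gamma> * z - \<gamma> * l * c))
      \<le> - (e / 2) * ((z\<^sup>2 + \<gamma> * l * c\<^sup>2) / 2 + e * c * z) + K * f\<^sup>2"
    using oscillator_lyapunov_coeffs[OF assms] by metis
  show ?thesis
  \<comment> \<open>The rate is that of the Lyapunov inequality; the factor 4 undoes the lower bound
    of \<open>V\<close> by a quarter of \<open>z\<^sup>2 + \<gamma> * l * c\<^sup>2\<close>.\<close>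
  proof (rule that[of "e / 2" "4 * K"])
    fix c z f :: "real \<Rightarrow> real" and T :: real
    assume T: "0 \<le> T" and c0: "c 0 = 0" "z 0 = 0"
      and c: "\<And>t. 0 \<le> t \<Longrightarrow> (c has_real_derivative z t) (at t within {0..})"
      and z: "\<And>t. 0 \<le> t \<Longrightarrow> (z has_real_derivative \<gamma> * f t - \<gamma> * z t - \<gamma> * l * c t) (at t within {0..})"
      and int: "set_integrable lborel {0..T} (\<lambda>t. exp (- (e / 2) * (T - t)) * (f t)\<^sup>2)"
    define V where "V t = ((z t)\<^sup>2 + \<gamma> * l * (c t)\<^sup>2) / 2 + e * c t * z t" for t
    define W where "W t = exp (- (e / 2) * (T - t)) * V t" for t
    define V' where "V' t = z t * (\<gamma> * f t - \<gamma> * z t - \<gamma> * l * c t) + \<gamma> * l * c t * z t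
        + e * (z t * z t + c t * (\<gamma> * f t - \<gamma> * z t - \<gamma> * l * c t))" for t
    have "(W has_real_derivative exp (- (e / 2) * (T - t)) * (V' t + (e / 2) * V t)) (at t within {0..T})"
      if t: "t \<in> {0..T}" for t
    proof -
      have "(c has_real_derivative z t) (at t within {0..T})"
        "(z has_real_derivative \<gamma> * f t - \<gamma> * z t - \<gamma> * l * c t) (at t within {0..T})"
        using t by (auto intro!: DERIV_subset[OF c] DERIV_subset[OF z])
      then have "(V has_real_derivative V' t) (at t within {0..T})"
        unfolding V_def V'_def
        by (auto intro!: derivative_eq_intros simp: field_simps power2_eq_square)
      then show ?thesis unfolding W_def
        by (auto intro!: derivative_eq_intros simp: algebra_simps)
    qed
    then have "((\<lambda>t. exp (- (e / 2) * (T - t)) * (V' t + (e / 2) * V t)) has_integral (W T - W 0)) {0..T}"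
      using T by (intro fundamental_theorem_of_calculus)
         (auto simp: has_real_derivative_iff_has_vector_derivative)
    moreover have "((\<lambda>t. K * (exp (- (e / 2) * (T - t)) * (f t)\<^sup>2)) has_integral
        (K * (LBINT t:{0..T}. exp (- (e / 2) * (T - t)) * (f t)\<^sup>2))) {0..T}"
      by (intro has_integral_mult_right has_integral_set_lborel int)
    ultimately have "W T - W 0 \<le> K * (LBINT t:{0..T}. exp (- (e / 2) * (T - t)) * (f t)\<^sup>2)"
    proof (rule has_integral_le)
      fix t assume "t \<in> {0..T}"
      have "V' t + (e / 2) * V t \<le> K * (f t)\<^sup>2"
        using der[of "z t" "f t" "c t"] unfolding V'_def V_def by argo
      then show "exp (- (e / 2) * (T - t)) * (V' t + (e / 2) * V t) \<le> K * (exp (- (e / 2) * (T - t)) * (f t)\<^sup>2)"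
        by (metis mult.left_commute mult_left_mono exp_ge_zero)
    qed
    moreover have "W 0 = 0" "W T = V T" using c0 by (auto simp: W_def V_def)
    moreover have "((z T)\<^sup>2 + \<gamma> * l * (c T)\<^sup>2) / 4 \<le> V T" using low by (simp add: V_def)
    ultimately show "(z T)\<^sup>2 + \<gamma> * l * (c T)\<^sup>2 \<le> 4 * K * (LBINT t:{0..T}. exp (- (e / 2) * (T - t)) * (f t)\<^sup>2)"
      by simp
  qed (use e in auto)
qed

text \<open>Substituting \<open>A * exp (- k * (s - t))\<close> into the equation gives the factor
  \<open>k\<^sup>2 + \<gamma> * k + \<gamma> * l\<close>, which determines \<open>A\<close>. The
  difference to this particular solution is a free damped oscillator, whose energy does not
  increase; since \<open>q\<close> and \<open>p\<close> start at 0, its initial energy comes from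
  the particular solution alone.\<close>

lemma oscillator_exponential_forcing:
  fixes \<gamma> l k S s :: real
  assumes pos: "0 < \<gamma>" "0 < l" "0 < k" "0 \<le> s" "0 \<le> S"
    and init: "q 0 = 0" "p 0 = 0"
    and q: "\<And>t. t \<in> {0..s} \<Longrightarrow> (q has_real_derivative p t) (at t within {0..s})"
    and p: "\<And>t. t \<in> {0..s} \<Longrightarrow>
      (p has_real_derivative \<gamma> * (S * exp (- k * (s - t))) - \<gamma> * p t - \<gamma> * l * q t) (at t within {0..s})"
  defines "A \<equiv> \<gamma> * S / (k\<^sup>2 + \<gamma> * k + \<gamma> * l)"
  shows "\<bar>p s - k * A\<bar> \<le> sqrt (k\<^sup>2 + \<gamma> * l) * A * exp (- k * s)"
proof -
  define n where "n = k\<^sup>2 + \<gamma> * k + \<gamma> * l"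
  have n: "0 < n" using pos by (simp add: n_def add_pos_pos)
  have A: "\<gamma> * S = n * A" "0 \<le> A" using n pos by (auto simp: A_def n_def)
  \<comment> \<open>Energy of the free oscillator obtained by subtracting the particular
    solution.\<close>
  define E where "E t = (p t - k * A * exp (- k * (s - t)))\<^sup>2 + \<gamma> * l * (q t - A * exp (- k * (s - t)))\<^sup>2" for t
  have "(E has_real_derivative - 2 * \<gamma> * (p t - k * A * exp (- k * (s - t)))\<^sup>2) (at t within {0..s})"
    if t: "t \<in> {0..s}" for t
  proof -
    define x where "x = exp (- k * (s - t))"
    have "(E has_real_derivative 2 * (p t - k * A * x) * (\<gamma> * (S * x) - \<gamma> * p t - \<gamma> * l * q t - k * A * (k * x))
        + \<gamma> * l * (2 * (q t - A * x) * (p t - A * (k * x)))) (at t within {0..s})"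
      unfolding E_def x_def using q[OF t] p[OF t]
      by (auto intro!: derivative_eq_intros simp: algebra_simps)
    also have "2 * (p t - k * A * x) * (\<gamma> * (S * x) - \<gamma> * p t - \<gamma> * l * q t - k * A * (k * x))
        + \<gamma> * l * (2 * (q t - A * x) * (p t - A * (k * x))) = - 2 * \<gamma> * (p t - k * A * x)\<^sup>2"
    proof -
      have "\<gamma> * (S * x) = (k\<^sup>2 + \<gamma> * k + \<gamma> * l) * A * x" using A(1) by (simp add: n_def)
      then show ?thesis by (simp add: power2_eq_square algebra_simps)
    qed
    finally show ?thesis by (simp add: x_def)
  qed
  then have "((\<lambda>t. - 2 * \<gamma> * (p t - k * A * exp (- k * (s - t)))\<^sup>2) has_integral (E s - E 0)) {0..s}"
    using pos by (intro fundamental_theorem_of_calculus)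
      (auto simp: has_real_derivative_iff_has_vector_derivative)
  then have "E s - E 0 \<le> 0"
    by (rule has_integral_le[OF _ has_integral_0]) (use pos in auto)
  moreover have "(p s - k * A)\<^sup>2 \<le> E s" using pos by (simp add: E_def)
  moreover have "E 0 = (k\<^sup>2 + \<gamma> * l) * (A * exp (- k * s))\<^sup>2"
    using init by (simp add: E_def power2_eq_square algebra_simps)
  ultimately have "sqrt ((p s - k * A)\<^sup>2) \<le> sqrt ((k\<^sup>2 + \<gamma> * l) * (A * exp (- k * s))\<^sup>2)"
    by (intro real_sqrt_le_mono) simp
  then show ?thesis using A(2) by (simp add: real_sqrt_mult abs_mult)
qed

section \<open>Exponential weights and indefinite Lebesgue integrals\<close>

lemma set_integral_exp_decay_le:
  fixes r T :: real
  assumes "0 < r" "0 \<le> T"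
  shows "set_integrable lborel {0..T} (\<lambda>t. exp (- r * (T - t)))"
    and "(LBINT t:{0..T}. exp (- r * (T - t))) \<le> 1 / r"
    and "set_integrable lborel {0..T} (\<lambda>t. exp (- r * t))"
    and "(LBINT t:{0..T}. exp (- r * t)) \<le> 1 / r"
proof -
  show i: "set_integrable lborel {0..T} (\<lambda>t. exp (- r * (T - t)))"
    "set_integrable lborel {0..T} (\<lambda>t. exp (- r * t))"
    by (intro borel_integrable_atLeastAtMost' continuous_intros)+
  have "((\<lambda>t. exp (- r * (T - t))) has_integral
      (exp (- r * (T - T)) / r - exp (- r * (T - 0)) / r)) {0..T}"
    using assms by (intro fundamental_theorem_of_calculus)
      (auto intro!: derivative_eq_intros simp flip: has_real_derivative_iff_has_vector_derivative)
  from has_integral_unique[OF has_integral_set_lborel[OF i(1)] this]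
  show "(LBINT t:{0..T}. exp (- r * (T - t))) \<le> 1 / r" using assms by simp
  have "((\<lambda>t. exp (- r * t)) has_integral
      (- exp (- r * T) / r - - exp (- r * 0) / r)) {0..T}"
    using assms by (intro fundamental_theorem_of_calculus)
      (auto intro!: derivative_eq_intros simp flip: has_real_derivative_iff_has_vector_derivative)
  from has_integral_unique[OF has_integral_set_lborel[OF i(2)] this]
  show "(LBINT t:{0..T}. exp (- r * t)) \<le> 1 / r" using assms by simp
qed

lemma continuous_on_set_integral_upto:
  fixes h :: "real \<Rightarrow> real"
  assumes "set_integrable lborel {0..s} h"
  shows "continuous_on {0..s} (\<lambda>t. LBINT a:{0..t}. h a)"
proof -
  have "set_integrable lborel {0..t} h" if "t \<in> {0..s}" for t
    using that by (intro set_integrable_subset[OF assms]) auto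
  then have "(LBINT a:{0..t}. h a) = integral {0..t} h" if "t \<in> {0..s}" for t
    using that set_borel_integral_eq_integral(2) by blast
  moreover have "continuous_on {0..s} (\<lambda>t. integral {0..t} h)"
    using assms by (intro indefinite_integral_continuous_1 set_borel_integral_eq_integral(1))
  ultimately show ?thesis using continuous_on_cong[OF refl] by (metis (no_types, lifting))
qed

lemma has_real_derivative_set_integral_upto:
  fixes h :: "real \<Rightarrow> real"
  assumes h: "continuous_on {0..s} h" and t: "t \<in> {0..s}"
  shows "((\<lambda>t. LBINT a:{0..t}. h a) has_real_derivative h t) (at t within {0..s})"
proof -
  have "set_integrable lborel {0..t} h" if "t \<in> {0..s}" for t
    using that by (intro borel_integrable_atLeastAtMost' continuous_on_subset[OF h]) auto
  then have eq: "(LBINT a:{0..t}. h a) = integral {0..t} h" if "t \<in> {0..s}" for t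
    using that set_borel_integral_eq_integral(2) by blast
  show ?thesis
    using integral_has_real_derivative[OF h t] eq t
    unfolding has_field_derivative_def by (auto intro: has_derivative_transform)
qed

section \<open>An oscillator driven by exponentially correlated noise\<close>

text \<open>A uniform bound on the first absolute moments over a bounded time interval gives
  integrability on the product space. Besides the exchange of integrals, this makes almost every
  path Lebesgue integrable, as required when matching it with a gauge integral.\<close>

lemma (in prob_space) interval_fubini:
  fixes X :: "real \<Rightarrow> 'a \<Rightarrow> real"
  assumes X[measurable]: "case_prod X \<in> borel_measurable (borel \<Otimes>\<^sub>M M)"
    and int: "\<forall>t\<in>{0..T}. integrable M (X t)"
    and bd: "\<forall>t\<in>{0..T}. expectation (\<lambda>w. \<bar>X t w\<bar>) \<le> B"
  shows "integrable M (\<lambda>w. LBINT t:{0..T}. X t w)"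
    and "expectation (\<lambda>w. LBINT t:{0..T}. X t w) = (LBINT t:{0..T}. expectation (X t))"
    and "AE w in M. set_integrable lborel {0..T} (\<lambda>t. X t w)"
    and "set_integrable lborel {0..T} (\<lambda>t. expectation (X t))"
proof -
  interpret P: pair_sigma_finite lborel M ..
  let ?F = "\<lambda>t w. indicat_real {0..T} t * X t w"
  have *: "integrable (lborel \<Otimes>\<^sub>M M) (case_prod ?F)"
  proof (rule P.Fubini_integrable)
    show "case_prod ?F \<in> borel_measurable (lborel \<Otimes>\<^sub>M M)" by measurable
    have "integrable lborel (\<lambda>t. indicat_real {0..T} t * expectation (\<lambda>w. \<bar>X t w\<bar>))"
    proof (rule Bochner_Integration.integrable_bound)
      show "integrable lborel (\<lambda>t. indicat_real {0..T} t * B)"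
        by (intro integrable_mult_left integrable_real_indicator) (auto simp: emeasure_lborel_Icc_eq)
      show "AE t in lborel. norm (indicat_real {0..T} t * expectation (\<lambda>w. \<bar>X t w\<bar>))
          \<le> norm (indicat_real {0..T} t * B)"
        using bd by (intro AE_I2) (auto simp: indicator_def intro: order_trans[OF _ abs_ge_self])
    qed measurable
    then show "integrable lborel (\<lambda>t. \<integral>w. norm (case_prod ?F (t, w)) \<partial>M)"
      by (simp add: abs_mult)
    show "AE t in lborel. integrable M (\<lambda>w. case_prod ?F (t, w))"
      using int by (intro AE_I2) (auto simp: indicator_def)
  qed
  show "integrable M (\<lambda>w. LBINT t:{0..T}. X t w)"
    using P.integrable_snd[OF *] by (simp add: set_lebesgue_integral_def)
  show "expectation (\<lambda>w. LBINT t:{0..T}. X t w) = (LBINT t:{0..T}. expectation (X t))"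
    using P.Fubini_integral[OF *] by (simp add: set_lebesgue_integral_def)
  show "AE w in M. set_integrable lborel {0..T} (\<lambda>t. X t w)"
    using P.AE_integrable_snd[OF *] by (simp add: set_integrable_def)
  show "set_integrable lborel {0..T} (\<lambda>t. expectation (X t))"
    using P.integrable_fst[OF *] by (simp add: set_integrable_def)
qed

lemma abs_mult_le_mean_squares: "\<bar>x * y\<bar> \<le> (x\<^sup>2 + y\<^sup>2) / 2" for x y :: real
proof -
  have "0 \<le> (\<bar>x\<bar> - \<bar>y\<bar>)\<^sup>2" by simp
  then show ?thesis by (simp add: power2_eq_square algebra_simps abs_mult)
qed

lemma (in prob_space) square_integrable_mult:
  fixes X Y :: "'a \<Rightarrow> real"
  assumes [measurable]: "X \<in> borel_measurable M" "Y \<in> borel_measurable M"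
    and X: "integrable M (\<lambda>w. (X w)\<^sup>2)" "expectation (\<lambda>w. (X w)\<^sup>2) \<le> B"
    and Y: "integrable M (\<lambda>w. (Y w)\<^sup>2)" "expectation (\<lambda>w. (Y w)\<^sup>2) \<le> B"
  shows "integrable M (\<lambda>w. X w * Y w)" "expectation (\<lambda>w. \<bar>X w * Y w\<bar>) \<le> B"
proof -
  have i: "integrable M (\<lambda>w. ((X w)\<^sup>2 + (Y w)\<^sup>2) / 2)" using X Y by simp
  show 1: "integrable M (\<lambda>w. X w * Y w)"
  proof (rule Bochner_Integration.integrable_bound[OF i])
    show "AE w in M. norm (X w * Y w) \<le> norm (((X w)\<^sup>2 + (Y w)\<^sup>2) / 2)"
      unfolding real_norm_def
      by (intro AE_I2 order_trans[OF abs_mult_le_mean_squares abs_ge_self])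
  qed measurable
  have "expectation (\<lambda>w. \<bar>X w * Y w\<bar>) \<le> expectation (\<lambda>w. ((X w)\<^sup>2 + (Y w)\<^sup>2) / 2)"
    using 1 i by (intro integral_mono abs_mult_le_mean_squares) auto
  also have "\<dots> \<le> B" using X Y by simp
  finally show "expectation (\<lambda>w. \<bar>X w * Y w\<bar>) \<le> B" .
qed

text \<open>One mode in isolation, with velocity \<open>z\<close> and inverse correlation time
  \<open>k\<close>. Square integrability is a separate assumption because a non-integrable product
  has Bochner integral 0, so for \<open>S = 0\<close> the covariance identity would not exclude
  it.\<close>

locale noise_driven_oscillator = prob_space M for M :: "'w measure" +
  fixes f z :: "real \<Rightarrow> 'w \<Rightarrow> real" and \<gamma> l k S :: real
  assumes \<gamma>_pos: "0 < \<gamma>" and l_pos: "0 < l" and k_pos: "0 < k"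
    and f_measurable[measurable]: "case_prod f \<in> borel_measurable (borel \<Otimes>\<^sub>M M)"
    and z_measurable[measurable]: "case_prod z \<in> borel_measurable (borel \<Otimes>\<^sub>M M)"
    and f_square_integrable: "\<And>t. 0 \<le> t \<Longrightarrow> integrable M (\<lambda>w. (f t w)\<^sup>2)"
    and f_covariance: "\<And>t s. \<lbrakk>0 \<le> t; 0 \<le> s\<rbrakk> \<Longrightarrow>
      expectation (\<lambda>w. f t w * f s w) = S * exp (- k * \<bar>t - s\<bar>)"
    and equation: "AE w in M. \<exists>c. c 0 = 0 \<and> z 0 w = 0 \<and> (\<forall>t\<ge>0.
      (c has_real_derivative z t w) (at t within {0..}) \<and>
      ((\<lambda>t. z t w) has_real_derivative \<gamma> * f t w - \<gamma> * z t w - \<gamma> * l * c t) (at t within {0..}))"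
begin

text \<open>The position is not assumed measurable; it is recovered from the velocity.\<close>

definition position :: "real \<Rightarrow> 'w \<Rightarrow> real" where
  "position t w = (LBINT a:{0..t}. z a w)"

lemma position_measurable[measurable]: "case_prod position \<in> borel_measurable (borel \<Otimes>\<^sub>M M)"
proof -
  \<comment> \<open>The upper limit varies with the parameter, so the interval is moved into the
    integrand as a condition; measurability of parameter integrals then applies.\<close>
  have "(\<lambda>x. \<integral>a. (if 0 \<le> a \<and> a \<le> fst x then z a (snd x) else 0) \<partial>lborel) \<in> borel_measurable (borel \<Otimes>\<^sub>M M)"
    by (rule lborel.borel_measurable_lebesgue_integral) measurable
  also have "(\<lambda>x. \<integral>a. (if 0 \<le> a \<and> a \<le> fst x then z a (snd x) else 0) \<partial>lborel) = case_prod position"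
    by (auto simp: position_def set_lebesgue_integral_def indicator_def fun_eq_iff
        intro!: Bochner_Integration.integral_cong)
  finally show ?thesis .
qed

lemma f_t_measurable[measurable]: "f t \<in> borel_measurable M"
  and z_t_measurable[measurable]: "z t \<in> borel_measurable M"
  and position_t_measurable[measurable]: "position t \<in> borel_measurable M"
proof -
  have "(\<lambda>w. case_prod f (t, w)) \<in> borel_measurable M" "(\<lambda>w. case_prod z (t, w)) \<in> borel_measurable M"
    "(\<lambda>w. case_prod position (t, w)) \<in> borel_measurable M"
    by measurable
  then show "f t \<in> borel_measurable M" "z t \<in> borel_measurable M" "position t \<in> borel_measurable M"
    by simp_all
qed

text \<open>The equation with the arbitrary, sample-dependent \<open>c\<close> replaced by the
  measurable \<open>position\<close>.\<close>

definition solution_path :: "'w \<Rightarrow> bool" where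
  "solution_path w \<longleftrightarrow> z 0 w = 0 \<and> (\<forall>t\<ge>0.
      ((\<lambda>t. position t w) has_real_derivative z t w) (at t within {0..}) \<and>
      ((\<lambda>t. z t w) has_real_derivative \<gamma> * f t w - \<gamma> * z t w - \<gamma> * l * position t w) (at t within {0..}))"

lemma position_0: "position 0 w = 0"
proof -
  have "set_integrable lborel {0..0::real} (\<lambda>a. z a w)"
    by (intro borel_integrable_atLeastAtMost') simp
  then show ?thesis
    by (simp add: position_def set_borel_integral_eq_integral)
qed

lemma solution_pathD:
  assumes "solution_path w"
  shows "z 0 w = 0"
    and "0 \<le> t \<Longrightarrow> ((\<lambda>t. position t w) has_real_derivative z t w) (at t within {0..})"
    and "0 \<le> t \<Longrightarrow>
      ((\<lambda>t. z t w) has_real_derivative \<gamma> * f t w - \<gamma> * z t w - \<gamma> * l * position t w) (at t within {0..})"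
  using assms by (auto simp: solution_path_def)

text \<open>The velocity of a solution is differentiable, hence continuous on the half-line, so
  integrating it recovers \<open>c\<close> for \<open>t \<ge> 0\<close>. The derivatives are taken
  within \<open>{0..}\<close>, so agreement there is enough.\<close>

lemma AE_solution_path: "AE w in M. solution_path w"
  using equation
proof eventually_elim
  fix w assume "\<exists>c. c 0 = 0 \<and> z 0 w = 0 \<and> (\<forall>t\<ge>0.
      (c has_real_derivative z t w) (at t within {0..}) \<and>
      ((\<lambda>t. z t w) has_real_derivative \<gamma> * f t w - \<gamma> * z t w - \<gamma> * l * c t) (at t within {0..}))"
  then obtain y where y: "y 0 = 0" "z 0 w = 0"
    "\<And>t. 0 \<le> t \<Longrightarrow> (y has_real_derivative z t w) (at t within {0..})"
    "\<And>t. 0 \<le> t \<Longrightarrow> ((\<lambda>t. z t w) has_real_derivative \<gamma> * f t w - \<gamma> * z t w - \<gamma> * l * y t) (at t within {0..})"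
    by blast
  have cont: "continuous_on {0..} (\<lambda>t. z t w)"
    using y(4) by (auto simp: continuous_on_eq_continuous_within intro: DERIV_continuous)
  have eq: "position t w = y t" if t: "0 \<le> t" for t
  proof -
    have "((\<lambda>a. z a w) has_integral (y t - y 0)) {0..t}"
      using t by (intro fundamental_theorem_of_calculus)
        (auto intro!: DERIV_subset[OF y(3)] simp flip: has_real_derivative_iff_has_vector_derivative)
    moreover have "((\<lambda>a. z a w) has_integral position t w) {0..t}"
      unfolding position_def
      by (intro has_integral_set_lborel borel_integrable_atLeastAtMost' continuous_on_subset[OF cont]) auto
    ultimately have "y t - y 0 = position t w" by (rule has_integral_unique)
    then show ?thesis using y(1) by simp
  qed
  have "((\<lambda>t. position t w) has_real_derivative z t w) (at t within {0..})" if "0 \<le> t" for t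
    using that has_derivative_transform[of t "{0..}" "\<lambda>t. position t w" y] eq y(3)[OF that]
    unfolding has_field_derivative_def by simp
  moreover have "((\<lambda>t. z t w) has_real_derivative \<gamma> * f t w - \<gamma> * z t w - \<gamma> * l * position t w) (at t within {0..})"
    if "0 \<le> t" for t
    using y(4)[OF that] eq[OF that] by simp
  ultimately show "solution_path w" unfolding solution_path_def using y(2) by blast
qed

section \<open>Second moments, uniformly in time\<close>

lemma f_variance: "0 \<le> t \<Longrightarrow> expectation (\<lambda>w. (f t w)\<^sup>2) = S"
  using f_covariance[of t t] by (simp add: power2_eq_square)

lemma S_nonneg: "0 \<le> S"
proof -
  have "0 \<le> expectation (\<lambda>w. (f 0 w)\<^sup>2)" by simp
  then show ?thesis using f_variance[of 0] by simp
qed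

text \<open>Expectation of the path-wise Lyapunov bound. The forcing has constant variance
  \<open>S\<close> and the discount integrates to at most \<open>1 / r\<close>, so
  \<open>K * (S / r)\<close> serves all times; an undiscounted integral would grow linearly in
  \<open>T\<close>.\<close>

lemma energy_bound:
  obtains B where "\<And>t. 0 \<le> t \<Longrightarrow> integrable M (\<lambda>w. (z t w)\<^sup>2 + \<gamma> * l * (position t w)\<^sup>2)"
    and "\<And>t. 0 \<le> t \<Longrightarrow> expectation (\<lambda>w. (z t w)\<^sup>2 + \<gamma> * l * (position t w)\<^sup>2) \<le> B"
proof -
  obtain r K where r: "0 < r" "0 < K"
    and bound: "\<And>y v g T. \<lbrakk>0 \<le> T; y 0 = 0; v 0 = 0;
        \<And>t. 0 \<le> t \<Longrightarrow> (y has_real_derivative v t) (at t within {0..});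
        \<And>t. 0 \<le> t \<Longrightarrow> (v has_real_derivative \<gamma> * g t - \<gamma> * v t - \<gamma> * l * y t) (at t within {0..});
        set_integrable lborel {0..T} (\<lambda>t. exp (- r * (T - t)) * (g t)\<^sup>2)\<rbrakk>
      \<Longrightarrow> (v T)\<^sup>2 + \<gamma> * l * (y T)\<^sup>2 \<le> K * (LBINT t:{0..T}. exp (- r * (T - t)) * (g t)\<^sup>2)"
    by (rule oscillator_bound[OF \<gamma>_pos l_pos]) blast
  have main: "integrable M (\<lambda>w. (z T w)\<^sup>2 + \<gamma> * l * (position T w)\<^sup>2) \<and>
      expectation (\<lambda>w. (z T w)\<^sup>2 + \<gamma> * l * (position T w)\<^sup>2) \<le> K * (S / r)" if T: "0 \<le> T" for T
  proof -
    let ?X = "\<lambda>t w. exp (- r * (T - t)) * (f t w)\<^sup>2"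
    let ?I = "\<lambda>w. LBINT t:{0..T}. ?X t w"
    have X: "case_prod ?X \<in> borel_measurable (borel \<Otimes>\<^sub>M M)" by measurable
    have E: "expectation (?X t) = S * exp (- r * (T - t))" if "t \<in> {0..T}" for t
      using that f_variance[of t] by simp
    have "integrable M (?X t)" if "t \<in> {0..T}" for t
      using that f_square_integrable by simp
    moreover have "expectation (\<lambda>w. \<bar>?X t w\<bar>) \<le> S" if "t \<in> {0..T}" for t
    proof -
      have "expectation (\<lambda>w. \<bar>?X t w\<bar>) = S * exp (- r * (T - t))" using E[OF that] by simp
      also have "\<dots> \<le> S * 1" using that r S_nonneg by (intro mult_left_mono) auto
      finally show ?thesis by simp
    qed
    ultimately have fub: "integrable M ?I"
        "expectation ?I = (LBINT t:{0..T}. expectation (?X t))"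
        "AE w in M. set_integrable lborel {0..T} (\<lambda>t. ?X t w)"
      using interval_fubini[OF X] by blast+
    have le: "AE w in M. (z T w)\<^sup>2 + \<gamma> * l * (position T w)\<^sup>2 \<le> K * ?I w"
      using AE_solution_path fub(3)
    proof eventually_elim
      fix w assume "solution_path w" "set_integrable lborel {0..T} (\<lambda>t. ?X t w)"
      then show "(z T w)\<^sup>2 + \<gamma> * l * (position T w)\<^sup>2 \<le> K * ?I w"
        by (intro bound[of T "\<lambda>t. position t w" "\<lambda>t. z t w" "\<lambda>t. f t w"])
          (auto simp: T position_0 solution_pathD)
    qed
    have nn: "0 \<le> (z T w)\<^sup>2 + \<gamma> * l * (position T w)\<^sup>2" for w using \<gamma>_pos l_pos by simp
    have i: "integrable M (\<lambda>w. (z T w)\<^sup>2 + \<gamma> * l * (position T w)\<^sup>2)"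
    proof (rule Bochner_Integration.integrable_bound)
      show "integrable M (\<lambda>w. K * ?I w)" using fub(1) by simp
      show "AE w in M. norm ((z T w)\<^sup>2 + \<gamma> * l * (position T w)\<^sup>2) \<le> norm (K * ?I w)"
        using le by eventually_elim (use nn in \<open>simp add: abs_of_nonneg\<close>)
    qed measurable
    have "expectation ?I = (LBINT t:{0..T}. S * exp (- r * (T - t)))"
      unfolding fub(2) by (rule set_lebesgue_integral_cong) (simp, use E in blast)
    then have EI: "expectation ?I = S * (LBINT t:{0..T}. exp (- r * (T - t)))" by simp
    have "expectation (\<lambda>w. (z T w)\<^sup>2 + \<gamma> * l * (position T w)\<^sup>2) \<le> expectation (\<lambda>w. K * ?I w)"
      using i fub(1) le by (intro integral_mono_AE) auto
    also have "\<dots> = K * expectation ?I" by simp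
    also have "\<dots> = K * (S * (LBINT t:{0..T}. exp (- r * (T - t))))" by (simp only: EI)
    also have "\<dots> \<le> K * (S * (1 / r))"
      using r S_nonneg T by (intro mult_left_mono set_integral_exp_decay_le) auto
    finally show ?thesis using i by simp
  qed
  show ?thesis by (rule that[of "K * (S / r)"]) (use main in auto)
qed

lemma moment_bound:
  obtains B where "0 \<le> B"
    and "\<And>t. 0 \<le> t \<Longrightarrow> integrable M (\<lambda>w. (z t w)\<^sup>2) \<and> expectation (\<lambda>w. (z t w)\<^sup>2) \<le> B"
    and "\<And>t. 0 \<le> t \<Longrightarrow> integrable M (\<lambda>w. (position t w)\<^sup>2) \<and> expectation (\<lambda>w. (position t w)\<^sup>2) \<le> B"
    and "\<And>t. 0 \<le> t \<Longrightarrow> integrable M (\<lambda>w. (f t w)\<^sup>2) \<and> expectation (\<lambda>w. (f t w)\<^sup>2) \<le> B"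
proof -
  obtain B where B: "\<And>t. 0 \<le> t \<Longrightarrow> integrable M (\<lambda>w. (z t w)\<^sup>2 + \<gamma> * l * (position t w)\<^sup>2)"
    "\<And>t. 0 \<le> t \<Longrightarrow> expectation (\<lambda>w. (z t w)\<^sup>2 + \<gamma> * l * (position t w)\<^sup>2) \<le> B"
    by (rule energy_bound) blast
  have gl: "0 < \<gamma> * l" using \<gamma>_pos l_pos by simp
  have z: "integrable M (\<lambda>w. (z t w)\<^sup>2)" and c': "integrable M (\<lambda>w. \<gamma> * l * (position t w)\<^sup>2)" if t: "0 \<le> t" for t
    by (rule Bochner_Integration.integrable_bound[OF B(1)[OF t]]; use gl in simp)+
  have c: "integrable M (\<lambda>w. (position t w)\<^sup>2)" if "0 \<le> t" for t
    using c'[OF that] gl by auto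
  have E: "expectation (\<lambda>w. (z t w)\<^sup>2) + \<gamma> * l * expectation (\<lambda>w. (position t w)\<^sup>2) \<le> B" if "0 \<le> t" for t
    using B(2)[OF that] z[OF that] c'[OF that] by simp
  have nn: "0 \<le> expectation (\<lambda>w. (z t w)\<^sup>2)" "0 \<le> expectation (\<lambda>w. (position t w)\<^sup>2)" for t
    by simp_all
  have Ez: "expectation (\<lambda>w. (z t w)\<^sup>2) \<le> B" if "0 \<le> t" for t
  proof -
    have "0 \<le> \<gamma> * l * expectation (\<lambda>w. (position t w)\<^sup>2)"
      using gl nn(2)[of t] by (intro mult_nonneg_nonneg[OF less_imp_le]) auto
    then show ?thesis using E[OF that] by linarith
  qed
  have Ec: "expectation (\<lambda>w. (position t w)\<^sup>2) \<le> B / (\<gamma> * l)" if "0 \<le> t" for t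
  proof -
    have "expectation (\<lambda>w. (position t w)\<^sup>2) * (\<gamma> * l) \<le> B"
      using E[OF that] nn(1)[of t] unfolding mult.commute[of _ "\<gamma> * l"] by linarith
    then show ?thesis using gl by (simp add: pos_le_divide_eq)
  qed
  have B0: "0 \<le> B" using Ez[of 0] nn(1)[of 0] by linarith
  have D: "0 \<le> B / (\<gamma> * l)" using B0 gl by simp
  show ?thesis
  \<comment> \<open>A sum of the three separate bounds, so that one constant covers velocity,
    position and force.\<close>
  proof (rule that[of "B + B / (\<gamma> * l) + S"])
    show "0 \<le> B + B / (\<gamma> * l) + S" using B0 D S_nonneg by linarith
    fix t :: real assume t: "0 \<le> t"
    show "integrable M (\<lambda>w. (z t w)\<^sup>2) \<and> expectation (\<lambda>w. (z t w)\<^sup>2) \<le> B + B / (\<gamma> * l) + S"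
      using z[OF t] Ez[OF t] D S_nonneg by linarith
    show "integrable M (\<lambda>w. (position t w)\<^sup>2) \<and> expectation (\<lambda>w. (position t w)\<^sup>2) \<le> B + B / (\<gamma> * l) + S"
      using c[OF t] Ec[OF t] B0 S_nonneg by linarith
    show "integrable M (\<lambda>w. (f t w)\<^sup>2) \<and> expectation (\<lambda>w. (f t w)\<^sup>2) \<le> B + B / (\<gamma> * l) + S"
      using f_square_integrable[OF t] f_variance[OF t] B0 D by linarith
  qed
qed

text \<open>By the arithmetic-geometric mean inequality the common second-moment bound passes to all
  products, at any two times. This supplies the hypotheses of \<open>interval_fubini\<close>
  below.\<close>

lemma product_bound:
  obtains B where "0 \<le> B"
    and "\<And>t s X Y. \<lbrakk>0 \<le> t; 0 \<le> s; X \<in> {f, z, position}; Y \<in> {f, z, position}\<rbrakk> \<Longrightarrow> integrable M (\<lambda>w. X t w * Y s w)"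
    and "\<And>t s X Y. \<lbrakk>0 \<le> t; 0 \<le> s; X \<in> {f, z, position}; Y \<in> {f, z, position}\<rbrakk> \<Longrightarrow>
      expectation (\<lambda>w. \<bar>X t w * Y s w\<bar>) \<le> B"
proof -
  obtain B where B: "0 \<le> B" 
    and "\<And>t. 0 \<le> t \<Longrightarrow> integrable M (\<lambda>w. (z t w)\<^sup>2) \<and> expectation (\<lambda>w. (z t w)\<^sup>2) \<le> B"
    and "\<And>t. 0 \<le> t \<Longrightarrow> integrable M (\<lambda>w. (position t w)\<^sup>2) \<and> expectation (\<lambda>w. (position t w)\<^sup>2) \<le> B"
    and "\<And>t. 0 \<le> t \<Longrightarrow> integrable M (\<lambda>w. (f t w)\<^sup>2) \<and> expectation (\<lambda>w. (f t w)\<^sup>2) \<le> B"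
    by (rule moment_bound) blast
  then have X: "X t \<in> borel_measurable M" "integrable M (\<lambda>w. (X t w)\<^sup>2)" "expectation (\<lambda>w. (X t w)\<^sup>2) \<le> B"
    if "0 \<le> t" "X \<in> {f, z, position}" for t X
    using that by auto
  show ?thesis
  proof (rule that[OF B])
    fix t s :: real and X Y
    assume ts: "0 \<le> t" "0 \<le> s" and XY: "X \<in> {f, z, position}" "Y \<in> {f, z, position}"
    note * = square_integrable_mult[OF X(1)[OF ts(1) XY(1)] X(1)[OF ts(2) XY(2)]
        X(2,3)[OF ts(1) XY(1)] X(2,3)[OF ts(2) XY(2)]]
    show "integrable M (\<lambda>w. X t w * Y s w)" "expectation (\<lambda>w. \<bar>X t w * Y s w\<bar>) \<le> B"
      by (rule *)+
  qed
qed

section \<open>Correlation of the response at one time with the force at a fixed time\<close>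

definition velocity_forcing :: "real \<Rightarrow> real \<Rightarrow> real" where
  "velocity_forcing t s = expectation (\<lambda>w. z t w * f s w)"

definition position_forcing :: "real \<Rightarrow> real \<Rightarrow> real" where
  "position_forcing t s = expectation (\<lambda>w. position t w * f s w)"

lemma position_forcing_eq:
  assumes s: "0 \<le> s" and t: "0 \<le> t"
  shows "set_integrable lborel {0..t} (\<lambda>a. velocity_forcing a s)"
    and "position_forcing t s = (LBINT a:{0..t}. velocity_forcing a s)"
proof -
  obtain B where
    B: "\<And>t s X Y. \<lbrakk>0 \<le> t; 0 \<le> s; X \<in> {f, z, position}; Y \<in> {f, z, position}\<rbrakk> \<Longrightarrow> integrable M (\<lambda>w. X t w * Y s w)"
    "\<And>t s X Y. \<lbrakk>0 \<le> t; 0 \<le> s; X \<in> {f, z, position}; Y \<in> {f, z, position}\<rbrakk> \<Longrightarrow>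
      expectation (\<lambda>w. \<bar>X t w * Y s w\<bar>) \<le> B"
    by (rule product_bound) blast
  have X: "case_prod (\<lambda>a w. z a w * f s w) \<in> borel_measurable (borel \<Otimes>\<^sub>M M)" by measurable
  have int: "\<forall>a\<in>{0..t}. integrable M (\<lambda>w. z a w * f s w)"
    and bd: "\<forall>a\<in>{0..t}. expectation (\<lambda>w. \<bar>z a w * f s w\<bar>) \<le> B"
    using B[of _ s z f] s by auto
  note fub = interval_fubini[OF X int bd]
  show "set_integrable lborel {0..t} (\<lambda>a. velocity_forcing a s)"
    using fub(4) by (simp add: velocity_forcing_def)
  show "position_forcing t s = (LBINT a:{0..t}. velocity_forcing a s)"
    using fub(2) by (simp add: velocity_forcing_def position_forcing_def position_def)
qed

text \<open>Multiply the time-integrated velocity equation by \<open>f s\<close> and exchange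
  expectation and time integral. The noise covariance enters here, as the deterministic forcing in
  \<open>h\<close>.\<close>

lemma velocity_forcing_eq:
  assumes s: "0 \<le> s" and t: "0 \<le> t"
  defines "h \<equiv> \<lambda>a. \<gamma> * (S * exp (- k * \<bar>a - s\<bar>)) - \<gamma> * velocity_forcing a s - \<gamma> * l * position_forcing a s"
  shows "set_integrable lborel {0..t} h"
    and "velocity_forcing t s = (LBINT a:{0..t}. h a)"
proof -
  obtain B where
    B: "\<And>t s X Y. \<lbrakk>0 \<le> t; 0 \<le> s; X \<in> {f, z, position}; Y \<in> {f, z, position}\<rbrakk> \<Longrightarrow> integrable M (\<lambda>w. X t w * Y s w)"
    "\<And>t s X Y. \<lbrakk>0 \<le> t; 0 \<le> s; X \<in> {f, z, position}; Y \<in> {f, z, position}\<rbrakk> \<Longrightarrow>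
      expectation (\<lambda>w. \<bar>X t w * Y s w\<bar>) \<le> B"
    by (rule product_bound) blast
  let ?X = "\<lambda>a w. (\<gamma> * f a w - \<gamma> * z a w - \<gamma> * l * position a w) * f s w"
  have X: "case_prod ?X \<in> borel_measurable (borel \<Otimes>\<^sub>M M)" by measurable
  have Xeq: "?X a = (\<lambda>w. \<gamma> * (f a w * f s w) - \<gamma> * (z a w * f s w) - \<gamma> * l * (position a w * f s w))" for a
    by (simp add: fun_eq_iff algebra_simps)
  have ints: "integrable M (\<lambda>w. f a w * f s w)" "integrable M (\<lambda>w. z a w * f s w)"
     "integrable M (\<lambda>w. position a w * f s w)" if "a \<in> {0..t}" for a
    using B(1)[of a s f f] B(1)[of a s z f] B(1)[of a s position f] s that by auto
  have int: "integrable M (?X a)" if "a \<in> {0..t}" for a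
    unfolding Xeq using ints[OF that] by simp
  have bd: "expectation (\<lambda>w. \<bar>?X a w\<bar>) \<le> \<gamma> * B + \<gamma> * B + \<gamma> * l * B" if a: "a \<in> {0..t}" for a
  proof -
    have "expectation (\<lambda>w. \<bar>?X a w\<bar>) \<le> expectation (\<lambda>w. \<gamma> * \<bar>f a w * f s w\<bar> + \<gamma> * \<bar>z a w * f s w\<bar>
        + \<gamma> * l * \<bar>position a w * f s w\<bar>)"
    proof (rule integral_mono)
      show "integrable M (\<lambda>w. \<bar>?X a w\<bar>)" using int[OF a] by simp
      fix w
      have "\<bar>x - y - u\<bar> \<le> \<bar>x\<bar> + \<bar>y\<bar> + \<bar>u\<bar>" for x y u :: real by linarith
      from this[of "\<gamma> * (f a w * f s w)" "\<gamma> * (z a w * f s w)" "\<gamma> * l * (position a w * f s w)"]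
      show "\<bar>?X a w\<bar> \<le> \<gamma> * \<bar>f a w * f s w\<bar> + \<gamma> * \<bar>z a w * f s w\<bar> + \<gamma> * l * \<bar>position a w * f s w\<bar>"
        unfolding fun_cong[OF Xeq] using \<gamma>_pos l_pos by (simp add: abs_mult)
    qed (use ints[OF a] in simp)
    also have "\<dots> = \<gamma> * expectation (\<lambda>w. \<bar>f a w * f s w\<bar>) + \<gamma> * expectation (\<lambda>w. \<bar>z a w * f s w\<bar>)
        + \<gamma> * l * expectation (\<lambda>w. \<bar>position a w * f s w\<bar>)"
      using ints[OF a] by simp
    also have "\<dots> \<le> \<gamma> * B + \<gamma> * B + \<gamma> * l * B"
      using B(2)[of a s f f] B(2)[of a s z f] B(2)[of a s position f] s a \<gamma>_pos l_pos
      by (intro add_mono mult_left_mono) auto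
    finally show ?thesis .
  qed
  have int': "\<forall>a\<in>{0..t}. integrable M (?X a)"
    by (intro ballI int)
  have bd': "\<forall>a\<in>{0..t}. expectation (\<lambda>w. \<bar>?X a w\<bar>) \<le> \<gamma> * B + \<gamma> * B + \<gamma> * l * B"
    by (intro ballI bd)
  note fub = interval_fubini[OF X int' bd']
  have E: "expectation (?X a) = h a" if a: "a \<in> {0..t}" for a
    unfolding Xeq h_def using ints[OF a] f_covariance[of a s] s a
    by (simp add: velocity_forcing_def position_forcing_def)
  show "set_integrable lborel {0..t} h"
  proof -
    have "set_integrable lborel {0..t} (\<lambda>a. expectation (?X a)) = set_integrable lborel {0..t} h"
      by (rule set_integrable_cong) (simp_all only: E)
    then show ?thesis using fub(4) by (rule iffD1)
  qed
  \<comment> \<open>The factor \<open>f s w\<close> is constant in the integration variable, and the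
    boundary term at 0 vanishes because the velocity starts at 0.\<close>
  have "AE w in M. z t w * f s w = (LBINT a:{0..t}. ?X a w)"
    using AE_solution_path fub(3)
  proof eventually_elim
    fix w assume w: "solution_path w" and i: "set_integrable lborel {0..t} (\<lambda>a. ?X a w)"
    have "((\<lambda>a. ?X a w) has_integral (z t w * f s w - z 0 w * f s w)) {0..t}"
      using t by (intro fundamental_theorem_of_calculus)
        (auto intro!: DERIV_cmult_right DERIV_subset[OF solution_pathD(3)[OF w]]
          simp flip: has_real_derivative_iff_has_vector_derivative)
    from has_integral_unique[OF has_integral_set_lborel[OF i] this]
    show "z t w * f s w = (LBINT a:{0..t}. ?X a w)"
      using solution_pathD(1)[OF w] by (metis diff_zero mult_zero_left)
  qed
  then have "velocity_forcing t s = expectation (\<lambda>w. LBINT a:{0..t}. ?X a w)"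
    unfolding velocity_forcing_def using fub(1) by (intro integral_cong_AE) auto
  also have "\<dots> = (LBINT a:{0..t}. expectation (?X a))" by (rule fub(2))
  also have "\<dots> = (LBINT a:{0..t}. h a)"
    by (rule set_lebesgue_integral_cong) (simp, intro allI impI E)
  finally show "velocity_forcing t s = (LBINT a:{0..t}. h a)" .
qed

text \<open>Velocity at \<open>t = s\<close> of the particular solution
  \<open>A * exp (- k * (s - t))\<close>.\<close>

definition stationary_response :: real where
  "stationary_response = k * (\<gamma> * S / (k\<^sup>2 + \<gamma> * k + \<gamma> * l))"

text \<open>The two integral equations on \<open>{0..s}\<close> form the oscillator equation with
  exponential forcing, since \<open>\<bar>t - s\<bar> = s - t\<close> there; the comparison with its
  particular solution is read off at the endpoint \<open>t = s\<close>.\<close>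

lemma velocity_forcing_diagonal:
  assumes s: "0 \<le> s"
  shows "\<bar>velocity_forcing s s - stationary_response\<bar>
    \<le> sqrt (k\<^sup>2 + \<gamma> * l) * (\<gamma> * S / (k\<^sup>2 + \<gamma> * k + \<gamma> * l)) * exp (- k * s)"
proof -
  let ?p = "\<lambda>t. velocity_forcing t s" and ?q = "\<lambda>t. position_forcing t s"
  let ?h = "\<lambda>a. \<gamma> * (S * exp (- k * \<bar>a - s\<bar>)) - \<gamma> * ?p a - \<gamma> * l * ?q a"
  have p: "?p t = (LBINT a:{0..t}. ?h a)" and q: "?q t = (LBINT a:{0..t}. ?p a)" if "t \<in> {0..s}" for t
    using velocity_forcing_eq(2) position_forcing_eq(2) s that by auto
  \<comment> \<open>Bootstrap: as indefinite integrals \<open>?p\<close> and \<open>?q\<close> are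
    continuous, hence so is \<open>?h\<close>, and integrals of continuous functions are
    differentiable.\<close>
  have cp: "continuous_on {0..s} ?p"
    using continuous_on_set_integral_upto[OF velocity_forcing_eq(1)[OF s s]] p
    by (metis (no_types, lifting) continuous_on_cong)
  have cq: "continuous_on {0..s} ?q"
    using continuous_on_set_integral_upto[OF position_forcing_eq(1)[OF s s]] q
    by (metis (no_types, lifting) continuous_on_cong)
  have ch: "continuous_on {0..s} ?h" by (intro continuous_intros cp cq)
  have dq: "(?q has_real_derivative ?p t) (at t within {0..s})" if "t \<in> {0..s}" for t
    using has_real_derivative_set_integral_upto[OF cp that] unfolding has_field_derivative_def
    by (rule has_derivative_transform[OF that, rotated]) (rule q)
  have dp: "(?p has_real_derivative ?h t) (at t within {0..s})" if "t \<in> {0..s}" for t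
    using has_real_derivative_set_integral_upto[OF ch that] unfolding has_field_derivative_def
    by (rule has_derivative_transform[OF that, rotated]) (rule p)
  have dp': "(?p has_real_derivative \<gamma> * (S * exp (- k * (s - t))) - \<gamma> * ?p t - \<gamma> * l * ?q t) (at t within {0..s})"
    if "t \<in> {0..s}" for t
  proof -
    have "\<bar>t - s\<bar> = s - t" using that by simp
    then show ?thesis using dp[OF that] by simp
  qed
  have "?p 0 = 0"
    using s p[of 0] set_borel_integral_eq_integral(2)[OF velocity_forcing_eq(1)[OF s order_refl]] by simp
  moreover have "?q 0 = 0" by (simp add: position_forcing_def position_0)
  ultimately show ?thesis
    unfolding stationary_response_def
    by (intro oscillator_exponential_forcing[where q = ?q]) (use \<gamma>_pos l_pos k_pos s S_nonneg dq dp' in auto)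
qed

section \<open>Time averages of the squared velocity\<close>

lemma kinetic_integrable: "integrable M (\<lambda>w. LBINT t:{0..T}. (z t w)\<^sup>2)"
  and AE_kinetic_set_integrable: "AE w in M. set_integrable lborel {0..T} (\<lambda>t. (z t w)\<^sup>2)"
proof -
  obtain B where
    B: "\<And>t. 0 \<le> t \<Longrightarrow> integrable M (\<lambda>w. (z t w)\<^sup>2) \<and> expectation (\<lambda>w. (z t w)\<^sup>2) \<le> B"
    by (rule moment_bound) blast
  have "case_prod (\<lambda>t w. (z t w)\<^sup>2) \<in> borel_measurable (borel \<Otimes>\<^sub>M M)" by measurable
  note fub = interval_fubini[OF this, where B = B and T = T]
  show "integrable M (\<lambda>w. LBINT t:{0..T}. (z t w)\<^sup>2)" "AE w in M. set_integrable lborel {0..T} (\<lambda>t. (z t w)\<^sup>2)"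
    using fub(1,3) B by auto
qed

text \<open>The restoring force contributes a total derivative, so
  \<open>z\<^sup>2 + \<gamma> * l * c\<^sup>2\<close> changes at rate
  \<open>2 * \<gamma> * (z * f - z\<^sup>2)\<close>. Started from 0, its expectation at
  \<open>T\<close> equals \<open>2 * \<gamma>\<close> times the difference of the two integrals, and
  \<open>energy_bound\<close> caps it independently of \<open>T\<close>.\<close>

lemma energy_balance:
  obtains D where "\<And>T. 0 \<le> T \<Longrightarrow>
    \<bar>expectation (\<lambda>w. LBINT t:{0..T}. (z t w)\<^sup>2) - (LBINT t:{0..T}. velocity_forcing t t)\<bar> \<le> D"
    and "\<And>T. 0 \<le> T \<Longrightarrow> set_integrable lborel {0..T} (\<lambda>t. velocity_forcing t t)"
proof -
  obtain B where
    B: "\<And>t s X Y. \<lbrakk>0 \<le> t; 0 \<le> s; X \<in> {f, z, position}; Y \<in> {f, z, position}\<rbrakk> \<Longrightarrow> integrable M (\<lambda>w. X t w * Y s w)"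
    "\<And>t s X Y. \<lbrakk>0 \<le> t; 0 \<le> s; X \<in> {f, z, position}; Y \<in> {f, z, position}\<rbrakk> \<Longrightarrow>
      expectation (\<lambda>w. \<bar>X t w * Y s w\<bar>) \<le> B"
    by (rule product_bound) blast
  obtain K where K: "\<And>t. 0 \<le> t \<Longrightarrow> integrable M (\<lambda>w. (z t w)\<^sup>2 + \<gamma> * l * (position t w)\<^sup>2)"
    "\<And>t. 0 \<le> t \<Longrightarrow> expectation (\<lambda>w. (z t w)\<^sup>2 + \<gamma> * l * (position t w)\<^sup>2) \<le> K"
    by (rule energy_bound) blast
  have X: "case_prod (\<lambda>t w. z t w * f t w) \<in> borel_measurable (borel \<Otimes>\<^sub>M M)" by measurable
  have main: "\<bar>expectation (\<lambda>w. LBINT t:{0..T}. (z t w)\<^sup>2) - (LBINT t:{0..T}. velocity_forcing t t)\<bar> \<le> K / (2 * \<gamma>)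
      \<and> set_integrable lborel {0..T} (\<lambda>t. velocity_forcing t t)" if T: "0 \<le> T" for T
  proof -
    have int: "\<forall>t\<in>{0..T}. integrable M (\<lambda>w. z t w * f t w)"
      and bd: "\<forall>t\<in>{0..T}. expectation (\<lambda>w. \<bar>z t w * f t w\<bar>) \<le> B"
      using B[of t t z f for t] by auto
    note fub = interval_fubini[OF X int bd]
    let ?J = "\<lambda>w. LBINT t:{0..T}. z t w * f t w" and ?I = "\<lambda>w. LBINT t:{0..T}. (z t w)\<^sup>2"
    have "AE w in M. (z T w)\<^sup>2 + \<gamma> * l * (position T w)\<^sup>2 = 2 * \<gamma> * (?J w - ?I w)"
      using AE_solution_path fub(3) AE_kinetic_set_integrable[of T]
    proof eventually_elim
      fix w assume w: "solution_path w" and i: "set_integrable lborel {0..T} (\<lambda>t. z t w * f t w)"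
        "set_integrable lborel {0..T} (\<lambda>t. (z t w)\<^sup>2)"
      have "((\<lambda>t. (z t w)\<^sup>2 + \<gamma> * l * (position t w)\<^sup>2) has_real_derivative
          2 * \<gamma> * (z t w * f t w - (z t w)\<^sup>2)) (at t within {0..T})" if "t \<in> {0..T}" for t
      proof -
        have "((\<lambda>t. position t w) has_real_derivative z t w) (at t within {0..T})"
          "((\<lambda>t. z t w) has_real_derivative \<gamma> * f t w - \<gamma> * z t w - \<gamma> * l * position t w) (at t within {0..T})"
          using that by (auto intro!: DERIV_subset[OF solution_pathD(2)[OF w]] DERIV_subset[OF solution_pathD(3)[OF w]])
        then show ?thesis
          by (auto intro!: derivative_eq_intros simp: algebra_simps power2_eq_square)
      qed
      then have "((\<lambda>t. 2 * \<gamma> * (z t w * f t w - (z t w)\<^sup>2)) has_integral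
          ((z T w)\<^sup>2 + \<gamma> * l * (position T w)\<^sup>2) - ((z 0 w)\<^sup>2 + \<gamma> * l * (position 0 w)\<^sup>2)) {0..T}"
        using T by (intro fundamental_theorem_of_calculus)
          (auto simp flip: has_real_derivative_iff_has_vector_derivative)
      moreover have "((\<lambda>t. 2 * \<gamma> * (z t w * f t w - (z t w)\<^sup>2)) has_integral 2 * \<gamma> * (?J w - ?I w)) {0..T}"
        by (intro has_integral_mult_right has_integral_diff has_integral_set_lborel i)
      ultimately show "(z T w)\<^sup>2 + \<gamma> * l * (position T w)\<^sup>2 = 2 * \<gamma> * (?J w - ?I w)"
        using solution_pathD(1)[OF w] by (auto simp: position_0 dest: has_integral_unique)
    qed
    then have "expectation (\<lambda>w. (z T w)\<^sup>2 + \<gamma> * l * (position T w)\<^sup>2) = expectation (\<lambda>w. 2 * \<gamma> * (?J w - ?I w))"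
      using fub(1) kinetic_integrable[of T] by (intro integral_cong_AE) auto
    also have "\<dots> = 2 * \<gamma> * ((LBINT t:{0..T}. velocity_forcing t t) - expectation ?I)"
      using fub(1,2) kinetic_integrable[of T] by (simp add: velocity_forcing_def)
    finally have eq: "2 * \<gamma> * ((LBINT t:{0..T}. velocity_forcing t t) - expectation ?I)
      = expectation (\<lambda>w. (z T w)\<^sup>2 + \<gamma> * l * (position T w)\<^sup>2)" ..
    have nn: "0 \<le> expectation (\<lambda>w. (z T w)\<^sup>2 + \<gamma> * l * (position T w)\<^sup>2)"
      using \<gamma>_pos l_pos by (intro integral_nonneg_AE) auto
    define y where "y = (LBINT t:{0..T}. velocity_forcing t t) - expectation ?I"
    have "0 \<le> 2 * \<gamma> * y" "2 * \<gamma> * y \<le> K"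
      using nn K(2)[OF T] eq by (simp_all add: y_def)
    then have "0 \<le> y" "y \<le> K / (2 * \<gamma>)" using \<gamma>_pos
      by (simp_all add: zero_le_mult_iff field_simps)
    then show ?thesis using fub(4) by (simp add: y_def velocity_forcing_def)
  qed
  show ?thesis by (rule that[of "K / (2 * \<gamma>)"]) (use main in auto)
qed

text \<open>Two errors stay bounded in \<open>T\<close>: the boundary energy by \<open>D\<close>,
  and the accumulated transient of the diagonal correlation by \<open>C / k\<close>, as
  \<open>exp (- k * t)\<close> is integrable. Division by \<open>T\<close> removes both.\<close>

lemma mean_kinetic_tendsto:
  "((\<lambda>T. 1 / T * expectation (\<lambda>w. LBINT t:{0..T}. (z t w)\<^sup>2)) \<longlongrightarrow> stationary_response) at_top"
proof -
  obtain D where D: "\<And>T. 0 \<le> T \<Longrightarrow>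
    \<bar>expectation (\<lambda>w. LBINT t:{0..T}. (z t w)\<^sup>2) - (LBINT t:{0..T}. velocity_forcing t t)\<bar> \<le> D"
    and i: "\<And>T. 0 \<le> T \<Longrightarrow> set_integrable lborel {0..T} (\<lambda>t. velocity_forcing t t)"
    by (rule energy_balance) blast
  define C where "C = sqrt (k\<^sup>2 + \<gamma> * l) * (\<gamma> * S / (k\<^sup>2 + \<gamma> * k + \<gamma> * l))"
  have C: "0 \<le> C" using \<gamma>_pos l_pos k_pos S_nonneg by (simp add: C_def)
  have G: "\<bar>(LBINT t:{0..T}. velocity_forcing t t) - T * stationary_response\<bar> \<le> C / k" if T: "0 \<le> T" for T
  proof -
    have c: "set_integrable lborel {0..T} (\<lambda>t. stationary_response)"
      by (intro borel_integrable_atLeastAtMost') simp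
    have "\<bar>(LBINT t:{0..T}. velocity_forcing t t) - T * stationary_response\<bar>
      = \<bar>LBINT t:{0..T}. velocity_forcing t t - stationary_response\<bar>"
      using i[OF T] c T by (simp add: set_integral_diff set_integral_const)
    also have "\<dots> \<le> (LBINT t:{0..T}. \<bar>velocity_forcing t t - stationary_response\<bar>)"
      using set_integral_norm_bound[OF set_integral_diff(1)[OF i[OF T] c]] by simp
    also have "\<dots> \<le> (LBINT t:{0..T}. C * exp (- k * t))"
    proof (rule set_integral_mono)
      show "set_integrable lborel {0..T} (\<lambda>t. \<bar>velocity_forcing t t - stationary_response\<bar>)"
        using set_integral_diff(1)[OF i[OF T] c] by (rule set_integrable_abs)
      show "set_integrable lborel {0..T} (\<lambda>t. C * exp (- k * t))"
        using set_integral_exp_decay_le(3)[OF k_pos T] by simp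
    qed (use velocity_forcing_diagonal in \<open>simp add: C_def\<close>)
    also have "\<dots> = C * (LBINT t:{0..T}. exp (- k * t))" by simp
    also have "\<dots> \<le> C * (1 / k)"
      using C T k_pos by (intro mult_left_mono set_integral_exp_decay_le)
    finally show ?thesis by simp
  qed
  have "((\<lambda>T. (1 / T * expectation (\<lambda>w. LBINT t:{0..T}. (z t w)\<^sup>2)) - stationary_response) \<longlongrightarrow> 0) at_top"
  proof (rule Lim_null_comparison)
    show "\<forall>\<^sub>F T in at_top. norm ((1 / T * expectation (\<lambda>w. LBINT t:{0..T}. (z t w)\<^sup>2)) - stationary_response)
        \<le> (D + C / k) / T"
      using eventually_gt_at_top[of 0]
    proof eventually_elim
      fix T :: real assume T: "0 < T"
      define I where "I = expectation (\<lambda>w. LBINT t:{0..T}. (z t w)\<^sup>2)"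
      have "\<bar>I - T * stationary_response\<bar> \<le> D + C / k"
        using D[of T] G[of T] T unfolding I_def by linarith
      then have "\<bar>I - T * stationary_response\<bar> / T \<le> (D + C / k) / T"
        using T by (intro divide_right_mono) auto
      also have "\<bar>I - T * stationary_response\<bar> / T = \<bar>(I - T * stationary_response) / T\<bar>"
        using T by simp
      also have "(I - T * stationary_response) / T = 1 / T * I - stationary_response"
        using T by (simp add: field_simps)
      finally show "norm ((1 / T * expectation (\<lambda>w. LBINT t:{0..T}. (z t w)\<^sup>2)) - stationary_response)
          \<le> (D + C / k) / T" by (simp add: I_def)
    qed
    show "((\<lambda>T. (D + C / k) / T) \<longlongrightarrow> 0) at_top"
      by (intro tendsto_divide_0[OF tendsto_const] filterlim_at_top_imp_at_infinity filterlim_ident)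
  qed
  then show ?thesis by (simp add: LIM_zero_iff)
qed

end

section \<open>Modes of the network\<close>

text \<open>As many orthonormal vectors as the dimension span the space; the residual of the
  expansion is orthogonal to all of them, hence to itself.\<close>

lemma orthonormal_expansion:
  fixes u :: "nat \<Rightarrow> real ^ 'n"
  assumes on: "\<forall>\<alpha>\<in>{1..CARD('n)}. \<forall>\<beta>\<in>{1..CARD('n)}. u \<alpha> \<bullet> u \<beta> = (if \<alpha> = \<beta> then 1 else 0)"
  shows "x = (\<Sum>\<alpha>\<in>{1..CARD('n)}. (u \<alpha> \<bullet> x) *\<^sub>R u \<alpha>)"
proof -
  let ?I = "{1..CARD('n)}"
  have inj: "inj_on u ?I"
    using on by (intro inj_onI) (metis zero_neq_one)
  have "pairwise orthogonal (u ` ?I)"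
    using on by (auto simp: pairwise_def orthogonal_def)
  moreover have "0 \<notin> u ` ?I" using on by force
  ultimately have "independent (u ` ?I)" by (rule pairwise_orthogonal_independent)
  moreover have "card (u ` ?I) = DIM(real ^ 'n)" using inj by (simp add: card_image)
  ultimately have span: "span (u ` ?I) = UNIV"
    by (metis card_eq_dim dim_UNIV finite_atLeastAtMost finite_imageI order_refl subset_UNIV top.extremum_uniqueI)
  let ?y = "x - (\<Sum>\<alpha>\<in>?I. (u \<alpha> \<bullet> x) *\<^sub>R u \<alpha>)"
  have *: "u \<beta> \<bullet> ?y = 0" if "\<beta> \<in> ?I" for \<beta>
  proof -
    have "(\<Sum>\<alpha>\<in>?I. (u \<alpha> \<bullet> x) * (u \<beta> \<bullet> u \<alpha>)) = (\<Sum>\<alpha>\<in>?I. if \<alpha> = \<beta> then u \<alpha> \<bullet> x else 0)"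
      using on that by (intro sum.cong) auto
    then show ?thesis using that by (simp add: inner_diff_right inner_sum_right)
  qed
  have **: "orthogonal ?y a" if "a \<in> span (u ` ?I)" for a
    by (rule orthogonal_to_span[OF that]) (use * in \<open>auto simp: orthogonal_def inner_commute\<close>)
  have "orthogonal ?y ?y" by (rule **) (simp only: span UNIV_I)
  then show ?thesis by (simp only: orthogonal_self right_minus_eq)
qed

lemma orthonormal_parseval:
  fixes u :: "nat \<Rightarrow> real ^ 'n"
  assumes on: "\<forall>\<alpha>\<in>{1..CARD('n)}. \<forall>\<beta>\<in>{1..CARD('n)}. u \<alpha> \<bullet> u \<beta> = (if \<alpha> = \<beta> then 1 else 0)"
  shows "x \<bullet> x = (\<Sum>\<alpha>\<in>{1..CARD('n)}. (u \<alpha> \<bullet> x)\<^sup>2)"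
proof -
  have "x \<bullet> x = x \<bullet> (\<Sum>\<alpha>\<in>{1..CARD('n)}. (u \<alpha> \<bullet> x) *\<^sub>R u \<alpha>)"
    using orthonormal_expansion[OF on, of x] by simp
  then show ?thesis
    by (simp add: inner_sum_right power2_eq_square inner_commute)
qed

lemma diag_matrix_mult_vec_nth [simp]: "(diag_matrix v *v x) $ i = v $ i * x $ i"
proof -
  have "(\<Sum>j\<in>UNIV. (if i = j then v $ i else 0) * x $ j) = (\<Sum>j\<in>UNIV. if j = i then v $ i * x $ j else 0)"
    by (intro sum.cong) auto
  then show ?thesis by (simp add: diag_matrix_def matrix_vector_mult_def)
qed

lemma inner_diag_matrix_left: "(diag_matrix v *v x) \<bullet> y = x \<bullet> (diag_matrix v *v y)"
  by (simp add: inner_vec_def algebra_simps)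

locale damped_network =
  fixes d :: "real ^ 'n" and L :: "real ^ 'n ^ 'n" and u :: "nat \<Rightarrow> real ^ 'n" and l :: "nat \<Rightarrow> real"
  assumes damping: "\<And>i. 0 < d $ i"
    and stable: "stable_laplacian L"
    and eigenbasis: "orthonormal_eigenbasis (damped_laplacian d L) u l"
    and l_1: "l 1 = 0"
begin

text \<open>With \<open>D = diag d\<close>: \<open>force_mode \<alpha> = D\<^sup>-\<^sup>1\<^sup>/\<^sup>2 u\<^sub>\<alpha>\<close> reads off the modal force, and
  \<open>state_mode \<alpha> = D\<^sup>1\<^sup>/\<^sup>2 u\<^sub>\<alpha>\<close> reads off the modal angle and frequency.\<close>

definition force_mode :: "nat \<Rightarrow> real ^ 'n" where
  "force_mode \<alpha> = (\<chi> i. u \<alpha> $ i / sqrt (d $ i))"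

definition state_mode :: "nat \<Rightarrow> real ^ 'n" where
  "state_mode \<alpha> = (\<chi> i. sqrt (d $ i) * u \<alpha> $ i)"

lemma orthonormal:
  "\<lbrakk>\<alpha> \<in> {1..CARD('n)}; \<beta> \<in> {1..CARD('n)}\<rbrakk> \<Longrightarrow> u \<alpha> \<bullet> u \<beta> = (if \<alpha> = \<beta> then 1 else 0)"
  using eigenbasis by (auto simp: orthonormal_eigenbasis_def)

lemma state_mode_eq: "state_mode \<alpha> = diag_matrix d *v force_mode \<alpha>"
proof -
  have "d $ i * (x / sqrt (d $ i)) = sqrt (d $ i) * x" for i x
  proof -
    have "d $ i * (x / sqrt (d $ i)) = (d $ i / sqrt (d $ i)) * x" by simp
    then show ?thesis using damping[of i] by (simp only: real_div_sqrt less_imp_le)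
  qed
  then show ?thesis by (simp add: vec_eq_iff state_mode_def force_mode_def)
qed

lemma laplacian_symmetric: "(L *v x) \<bullet> y = x \<bullet> (L *v y)"
proof -
  have "transpose L = L" using stable by (simp add: stable_laplacian_def)
  then show ?thesis by (metis dot_lmul_matrix vector_transpose_matrix)
qed

text \<open>Clearing the factors \<open>1 / sqrt (d $ i)\<close> from the eigenvalue equation leaves
  the generalized problem \<open>L v = l D v\<close>, with \<open>v\<close> the force mode and
  \<open>D v\<close> the state mode.\<close>

lemma laplacian_force_mode:
  assumes "\<alpha> \<in> {1..CARD('n)}"
  shows "L *v force_mode \<alpha> = l \<alpha> *\<^sub>R state_mode \<alpha>"
proof -
  let ?R = "diag_matrix (\<chi> i. 1 / sqrt (d $ i))"
  have "?R *v u \<alpha> = force_mode \<alpha>" by (simp add: vec_eq_iff force_mode_def)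
  then have "damped_laplacian d L *v u \<alpha> = ?R *v (L *v force_mode \<alpha>)"
    by (simp add: damped_laplacian_def flip: matrix_vector_mul_assoc)
  moreover have "damped_laplacian d L *v u \<alpha> = l \<alpha> *\<^sub>R u \<alpha>"
    using eigenbasis assms by (simp add: orthonormal_eigenbasis_def)
  ultimately have "?R *v (L *v force_mode \<alpha>) = l \<alpha> *\<^sub>R u \<alpha>" by simp
  then have "(L *v force_mode \<alpha>) $ i / sqrt (d $ i) = l \<alpha> * u \<alpha> $ i" for i
    by (simp add: vec_eq_iff)
  moreover have "x / sqrt (d $ i) = y \<longleftrightarrow> x = y * sqrt (d $ i)" for i x y
  proof -
    have "sqrt (d $ i) \<noteq> 0" using damping[of i] by simp
    from nonzero_divide_eq_eq[OF this] show ?thesis .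
  qed
  ultimately show ?thesis by (simp add: vec_eq_iff state_mode_def)
qed

lemma force_mode_inner_state_mode: "force_mode \<alpha> \<bullet> state_mode \<beta> = u \<alpha> \<bullet> u \<beta>"
  using damping by (simp add: inner_vec_def force_mode_def state_mode_def less_imp_neq[THEN not_sym])

text \<open>The kernel is one-dimensional and contains the normalized all-ones vector, which
  therefore spans it.\<close>

lemma laplacian_kernel:
  assumes "L *v x = 0"
  obtains a where "x = (\<chi> i. a)"
proof -
  define e :: "real ^ 'n" where "e = (\<chi> i. 1 / sqrt (real CARD('n)))"
  have k: "dim {x. L *v x = 0} = 1" "e \<in> {x. L *v x = 0}"
    using stable by (simp_all add: stable_laplacian_def e_def)
  have e0: "e \<noteq> 0" by (simp add: e_def vec_eq_iff)
  have "{x. L *v x = 0} \<subseteq> span {e}"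
  proof (rule card_ge_dim_independent)
    show "independent {e}" using e0 by simp
  qed (use k in auto)
  then have "x \<in> span {e}" using assms by auto
  then obtain r where "x = r *\<^sub>R e" by (auto simp: span_singleton)
  then have "x = (\<chi> i. r / sqrt (real CARD('n)))" by (simp add: e_def vec_eq_iff)
  then show ?thesis by (rule that)
qed

text \<open>The eigenvalue 0 and the one-dimensional kernel of \<open>L\<close> force
  \<open>u 1\<close> to be proportional to the vector of the \<open>sqrt (d $ i)\<close>; its sign
  stays open, and only a nonzero factor matters below.\<close>

lemma first_mode:
  obtains a where "a \<noteq> 0" "force_mode 1 = (\<chi> i. a)"
proof -
  have 1: "1 \<in> {1..CARD('n)}" by (simp add: Suc_leI)
  have "L *v force_mode 1 = 0" using laplacian_force_mode[OF 1] l_1 by simp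
  then obtain a where a: "force_mode 1 = (\<chi> i. a)" by (rule laplacian_kernel)
  have "force_mode 1 \<bullet> state_mode 1 = 1" using force_mode_inner_state_mode orthonormal[OF 1 1] by simp
  then have "force_mode 1 \<noteq> 0" by auto
  with a have "a \<noteq> 0" by (auto simp: vec_eq_iff)
  then show ?thesis using a by (rule that)
qed

text \<open>Semidefiniteness excludes negative values. A second eigenvalue 0 would put the force
  mode into the kernel, parallel to the first one, against orthonormality.\<close>

lemma eigenvalue_pos:
  assumes \<alpha>: "\<alpha> \<in> {2..CARD('n)}"
  shows "0 < l \<alpha>"
proof -
  have 1: "1 \<in> {1..CARD('n)}" "\<alpha> \<in> {1..CARD('n)}" using \<alpha> by auto
  have "force_mode \<alpha> \<bullet> (L *v force_mode \<alpha>) = l \<alpha>"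
    using laplacian_force_mode[OF 1(2)] force_mode_inner_state_mode orthonormal[OF 1(2) 1(2)] by simp
  then have "0 \<le> l \<alpha>" using stable by (metis stable_laplacian_def)
  moreover have "l \<alpha> \<noteq> 0"
  proof
    assume "l \<alpha> = 0"
    then have "L *v force_mode \<alpha> = 0" using laplacian_force_mode[OF 1(2)] by simp
    then obtain b where b: "force_mode \<alpha> = (\<chi> i. b)" by (rule laplacian_kernel)
    obtain a where a: "a \<noteq> 0" "force_mode 1 = (\<chi> i. a)" by (rule first_mode)
    have "force_mode \<alpha> = (b / a) *\<^sub>R force_mode 1" using a b by (simp add: vec_eq_iff)
    then have "force_mode \<alpha> \<bullet> state_mode \<alpha> = (b / a) * (force_mode 1 \<bullet> state_mode \<alpha>)" by simp
    then have "u \<alpha> \<bullet> u \<alpha> = (b / a) * (u 1 \<bullet> u \<alpha>)" by (simp only: force_mode_inner_state_mode)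
    then show False using orthonormal[OF 1(2) 1(2)] orthonormal[OF 1] \<alpha> by simp
  qed
  ultimately show ?thesis by simp
qed

text \<open>The effort is the squared norm of \<open>y\<close>, the deviation from the average
  scaled by \<open>sqrt (d $ i)\<close>, so Parseval applies. The first mode drops out because the
  average is weighted by \<open>d\<close>; the others do not see the average, since constant vectors
  are multiples of the first force mode.\<close>

lemma effort_modes:
  "(v - network_average d v) \<bullet> (diag_matrix d *v (v - network_average d v))
    = (\<Sum>\<alpha>=2..CARD('n). (state_mode \<alpha> \<bullet> v)\<^sup>2)"
proof -
  define a where "a = (\<Sum>i\<in>UNIV. d $ i * v $ i) / (\<Sum>i\<in>UNIV. d $ i)"
  have avg: "network_average d v = (\<chi> i. a)" by (simp add: network_average_def a_def)
  have dpos: "0 < (\<Sum>i\<in>UNIV. d $ i)" using damping by (intro sum_pos) auto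
  define y where "y = (\<chi> i. sqrt (d $ i) * (v $ i - a))"
  have uy: "u \<alpha> \<bullet> y = state_mode \<alpha> \<bullet> (v - (\<chi> i. a))" for \<alpha>
    by (simp add: inner_vec_def y_def state_mode_def algebra_simps)
  obtain c where c: "c \<noteq> 0" "force_mode 1 = (\<chi> i. c)" by (rule first_mode)
  have const: "(\<chi> i. a) = (a / c) *\<^sub>R force_mode 1" using c by (simp add: vec_eq_iff)
  have "state_mode 1 \<bullet> (v - (\<chi> i. a)) = c * (\<Sum>i\<in>UNIV. d $ i * (v $ i - a))"
    by (simp add: state_mode_eq c(2) inner_vec_def sum_distrib_left algebra_simps del: One_nat_def)
  also have "(\<Sum>i\<in>UNIV. d $ i * (v $ i - a)) = (\<Sum>i\<in>UNIV. d $ i * v $ i) - a * (\<Sum>i\<in>UNIV. d $ i)"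
    by (simp add: sum_subtractf sum_distrib_left algebra_simps)
  also have "\<dots> = 0" using dpos by (simp add: a_def)
  finally have 1: "u 1 \<bullet> y = 0" by (simp add: uy)
  have other: "u \<alpha> \<bullet> y = state_mode \<alpha> \<bullet> v" if "\<alpha> \<in> {2..CARD('n)}" for \<alpha>
  proof -
    have "force_mode 1 \<bullet> state_mode \<alpha> = 0"
      using that orthonormal[of 1 \<alpha>] by (simp add: force_mode_inner_state_mode)
    then have "state_mode \<alpha> \<bullet> (\<chi> i. a) = 0"
      by (simp add: const inner_commute del: One_nat_def)
    then show ?thesis by (simp add: uy inner_diff_right)
  qed
  have "(v - network_average d v) \<bullet> (diag_matrix d *v (v - network_average d v)) = y \<bullet> y"
    unfolding avg inner_vec_def
  proof (rule sum.cong)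
    fix i
    have "(y $ i)\<^sup>2 = d $ i * (v $ i - a)\<^sup>2"
      using damping[of i] by (simp add: y_def power_mult_distrib)
    then show "(v - (\<chi> i. a)) $ i \<bullet> (diag_matrix d *v (v - (\<chi> i. a))) $ i = y $ i \<bullet> y $ i"
      by (simp add: power2_eq_square mult_ac)
  qed simp
  also have "\<dots> = (\<Sum>\<alpha>\<in>{1..CARD('n)}. (u \<alpha> \<bullet> y)\<^sup>2)"
    using orthonormal by (intro orthonormal_parseval) blast
  also have "{1..CARD('n)} = insert 1 {2..CARD('n)}" by (auto simp: Suc_leI)
  also have "(\<Sum>\<alpha>\<in>\<dots>. (u \<alpha> \<bullet> y)\<^sup>2) = (\<Sum>\<alpha>=2..CARD('n). (state_mode \<alpha> \<bullet> v)\<^sup>2)"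
  proof -
    have "(\<Sum>\<alpha>\<in>{2..CARD('n)}. (u \<alpha> \<bullet> y)\<^sup>2) = (\<Sum>\<alpha>\<in>{2..CARD('n)}. (state_mode \<alpha> \<bullet> v)\<^sup>2)"
      using other by (intro sum.cong) simp_all
    then show ?thesis using 1 by (simp del: One_nat_def)
  qed
  finally show ?thesis .
qed

text \<open>The constant ratio makes the inertia matrix equal to \<open>D / \<gamma>\<close>, so the
  eigenvectors that diagonalize the damped Laplacian decouple inertia and damping as well.\<close>

lemma mode_equation:
  assumes \<gamma>: "\<And>i. d $ i / m $ i = \<gamma>" and m: "\<And>i. 0 < m $ i"
    and sol: "linearized_swing_solution m d L p \<theta> \<omega>"
    and \<alpha>: "\<alpha> \<in> {1..CARD('n)}" and t: "0 \<le> t"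
  shows "((\<lambda>t. state_mode \<alpha> \<bullet> \<theta> t) has_real_derivative state_mode \<alpha> \<bullet> \<omega> t) (at t within {0..})"
    and "((\<lambda>t. state_mode \<alpha> \<bullet> \<omega> t) has_real_derivative
        \<gamma> * (force_mode \<alpha> \<bullet> p t) - \<gamma> * (state_mode \<alpha> \<bullet> \<omega> t) - \<gamma> * l \<alpha> * (state_mode \<alpha> \<bullet> \<theta> t))
        (at t within {0..})"
proof -
  obtain a where th: "(\<theta> has_vector_derivative \<omega> t) (at t within {0..})"
    and om: "(\<omega> has_vector_derivative a) (at t within {0..})"
    and eq: "diag_matrix m *v a + diag_matrix d *v \<omega> t = p t - L *v \<theta> t"
    using sol t by (auto simp: linearized_swing_solution_def)
  show "((\<lambda>t. state_mode \<alpha> \<bullet> \<theta> t) has_real_derivative state_mode \<alpha> \<bullet> \<omega> t) (at t within {0..})"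
    using bounded_linear.has_vector_derivative[OF bounded_linear_inner_right th]
    by (simp add: has_real_derivative_iff_has_vector_derivative)
  have dm: "d $ i = \<gamma> * m $ i" for i using \<gamma>[of i] m[of i] by (simp add: field_simps)
  have "state_mode \<alpha> \<bullet> a = \<gamma> * (force_mode \<alpha> \<bullet> (diag_matrix m *v a))"
    by (simp add: state_mode_eq inner_vec_def dm sum_distrib_left algebra_simps)
  also have "diag_matrix m *v a = p t - L *v \<theta> t - diag_matrix d *v \<omega> t"
    using eq by (simp add: algebra_simps)
  also have "force_mode \<alpha> \<bullet> \<dots> = force_mode \<alpha> \<bullet> p t - (L *v force_mode \<alpha>) \<bullet> \<theta> t - state_mode \<alpha> \<bullet> \<omega> t"
    by (simp add: inner_diff_right state_mode_eq inner_diag_matrix_left laplacian_symmetric)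
  also have "L *v force_mode \<alpha> = l \<alpha> *\<^sub>R state_mode \<alpha>" by (rule laplacian_force_mode[OF \<alpha>])
  finally have "state_mode \<alpha> \<bullet> a = \<gamma> * (force_mode \<alpha> \<bullet> p t) - \<gamma> * (state_mode \<alpha> \<bullet> \<omega> t)
      - \<gamma> * l \<alpha> * (state_mode \<alpha> \<bullet> \<theta> t)"
    by (simp add: algebra_simps)
  then show "((\<lambda>t. state_mode \<alpha> \<bullet> \<omega> t) has_real_derivative
        \<gamma> * (force_mode \<alpha> \<bullet> p t) - \<gamma> * (state_mode \<alpha> \<bullet> \<omega> t) - \<gamma> * l \<alpha> * (state_mode \<alpha> \<bullet> \<theta> t))
        (at t within {0..})"
    using bounded_linear.has_vector_derivative[OF bounded_linear_inner_right om, of "state_mode \<alpha>"]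
    by (simp add: has_real_derivative_iff_has_vector_derivative)
qed

end

section \<open>From the network noise to the control effort\<close>

text \<open>Processes are constrained only at nonnegative times; \<open>max t 0\<close> freezes them before time 0, so
  that the measurability results on all of \<open>borel\<close> apply.\<close>

lemma measurable_process_extend:
  assumes "measurable_process M X"
  shows "(\<lambda>(t, w). X (max t 0) w) \<in> borel_measurable (borel \<Otimes>\<^sub>M M)"
proof -
  have "(\<lambda>x. max (fst x) (0::real)) \<in> borel_measurable (borel \<Otimes>\<^sub>M M)" by measurable
  then have "(\<lambda>x. max (fst x) (0::real)) \<in> borel \<Otimes>\<^sub>M M \<rightarrow>\<^sub>M restrict_space borel {0..}"
    by (rule measurable_restrict_space2[rotated]) (simp add: Pi_def)
  then have "(\<lambda>x. (max (fst x) (0::real), snd x)) \<in> borel \<Otimes>\<^sub>M M \<rightarrow>\<^sub>M restrict_space borel {0..} \<Otimes>\<^sub>M M"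
    using measurable_snd by (rule measurable_Pair)
  from measurable_compose[OF this assms[unfolded measurable_process_def]]
  show ?thesis by (simp add: split_beta')
qed

section \<open>Moments of the projected noise\<close>

lemma (in prob_space) gaussian_variable_square_integrable:
  assumes "gaussian_variable M X"
  shows "integrable M (\<lambda>w. (X w)\<^sup>2)"
proof -
  have [measurable]: "X \<in> borel_measurable M" using assms by (simp add: gaussian_variable_def)
  consider \<mu> where "AE w in M. X w = \<mu>"
    | \<mu> \<sigma> where "0 < \<sigma>" "distributed M lborel X (normal_density \<mu> \<sigma>)"
    using assms by (auto simp: gaussian_variable_def)
  then show ?thesis
  proof cases
    case (1 \<mu>)
    have "integrable M (\<lambda>w. (X w)\<^sup>2) \<longleftrightarrow> integrable M (\<lambda>w. \<mu>\<^sup>2)"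
      using 1 by (intro integrable_cong_AE) auto
    then show ?thesis by simp
  next
    case (2 \<mu> \<sigma>)
    \<comment> \<open>Expansion of \<open>x\<^sup>2\<close> around \<mu>, since
      \<open>integrable_normal_moment\<close> speaks of centred moments.\<close>
    have "integrable lborel (\<lambda>x. normal_density \<mu> \<sigma> x * (x - \<mu>)\<^sup>2
        + 2 * \<mu> * (normal_density \<mu> \<sigma> x * (x - \<mu>) ^ 1) + \<mu>\<^sup>2 * (normal_density \<mu> \<sigma> x * (x - \<mu>) ^ 0))"
      using 2 by (intro Bochner_Integration.integrable_add integrable_mult_right integrable_normal_moment)
    also have "(\<lambda>x. normal_density \<mu> \<sigma> x * (x - \<mu>)\<^sup>2
        + 2 * \<mu> * (normal_density \<mu> \<sigma> x * (x - \<mu>) ^ 1) + \<mu>\<^sup>2 * (normal_density \<mu> \<sigma> x * (x - \<mu>) ^ 0))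
      = (\<lambda>x. normal_density \<mu> \<sigma> x * x\<^sup>2)"
      by (simp add: fun_eq_iff power2_eq_square algebra_simps)
    finally show ?thesis using distributed_integrable[OF 2(2), of "\<lambda>x. x\<^sup>2"] by simp
  qed
qed

text \<open>Gaussian components are square integrable, so their pairwise products are integrable and
  expectation passes through the double sum over nodes, of which only the diagonal survives.\<close>

lemma (in prob_space) correlated_noise_moments:
  fixes X :: "real \<Rightarrow> 'a \<Rightarrow> real ^ 'n" and v :: "real ^ 'n"
  assumes noise: "correlated_noise M N \<sigma> \<tau> X" and t: "0 \<le> t" and s: "0 \<le> s"
  shows "integrable M (\<lambda>w. (v \<bullet> X t w) * (v \<bullet> X s w))"
    and "expectation (\<lambda>w. (v \<bullet> X t w) * (v \<bullet> X s w))
      = (\<Sum>i\<in>N. (\<sigma> $ i)\<^sup>2 * (v $ i)\<^sup>2) * exp (- \<bar>t - s\<bar> / \<tau>)"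
proof -
  have gv: "gaussian_variable M (\<lambda>w. X t w $ i)" if "i \<in> N" "0 \<le> t" for i t
  proof -
    have "gaussian_process M ({0..} \<times> N) (\<lambda>(t, i) w. X t w $ i)"
      using noise by (simp add: correlated_noise_def)
    then have "gaussian_variable M (\<lambda>w. \<Sum>x\<in>{(t, i)}. 1 * (case x of (t, i) \<Rightarrow> \<lambda>w. X t w $ i) w)"
      unfolding gaussian_process_def using that
      by (elim allE[of _ "{(t, i)}"] allE[of _ "\<lambda>_. 1"]) auto
    then show ?thesis by simp
  qed
  have meas: "(\<lambda>w. X t w $ i) \<in> borel_measurable M" if "i \<in> N" "0 \<le> t" for i t
    using gv[OF that] by (simp add: gaussian_variable_def)
  have int: "integrable M (\<lambda>w. X t w $ i * X s w $ j)" if "i \<in> N" "j \<in> N" for i j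
    using square_integrable_mult(1)[OF meas[OF that(1) t] meas[OF that(2) s]
        gaussian_variable_square_integrable[OF gv[OF that(1) t]] max.cobounded1
        gaussian_variable_square_integrable[OF gv[OF that(2) s]] max.cobounded2] .
  \<comment> \<open>Restricting the inner product to \<open>N\<close> uses that the noise vanishes
    at the other nodes, which is given on \<open>space M\<close>.\<close>
  have eq: "(v \<bullet> X t w) * (v \<bullet> X s w)
      = (\<Sum>i\<in>N. \<Sum>j\<in>N. v $ i * v $ j * (X t w $ i * X s w $ j))" if "w \<in> space M" for w
  proof -
    have *: "v \<bullet> X t w = (\<Sum>i\<in>N. v $ i * X t w $ i)" if "0 \<le> t" for t
    proof -
      have "(\<Sum>i\<in>N. v $ i * X t w $ i) = (\<Sum>i\<in>UNIV. v $ i * X t w $ i)"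
        using noise \<open>w \<in> space M\<close> that
        by (intro sum.mono_neutral_left) (auto simp: correlated_noise_def)
      then show ?thesis by (simp add: inner_vec_def)
    qed
    show ?thesis unfolding *[OF t] *[OF s] sum_product by (intro sum.cong refl) simp
  qed
  have "integrable M (\<lambda>w. \<Sum>i\<in>N. \<Sum>j\<in>N. v $ i * v $ j * (X t w $ i * X s w $ j))"
    using int by (intro Bochner_Integration.integrable_sum integrable_mult_right)
  then show "integrable M (\<lambda>w. (v \<bullet> X t w) * (v \<bullet> X s w))"
    by (subst Bochner_Integration.integrable_cong[OF refl eq])
  have cov: "expectation (\<lambda>w. X t w $ i * X s w $ j)
      = (if i = j then (\<sigma> $ i)\<^sup>2 * exp (- \<bar>t - s\<bar> / \<tau>) else 0)" if "i \<in> N" "j \<in> N" for i j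
    using noise that t s by (simp add: correlated_noise_def)
  have "expectation (\<lambda>w. (v \<bullet> X t w) * (v \<bullet> X s w))
      = expectation (\<lambda>w. \<Sum>i\<in>N. \<Sum>j\<in>N. v $ i * v $ j * (X t w $ i * X s w $ j))"
    by (intro Bochner_Integration.integral_cong refl eq)
  also have "\<dots> = (\<Sum>i\<in>N. \<Sum>j\<in>N. v $ i * v $ j * expectation (\<lambda>w. X t w $ i * X s w $ j))"
    using int by simp
  also have "\<dots> = (\<Sum>i\<in>N. \<Sum>j\<in>N. if j = i then (\<sigma> $ i)\<^sup>2 * (v $ i)\<^sup>2 * exp (- \<bar>t - s\<bar> / \<tau>) else 0)"
    by (intro sum.cong refl) (simp add: cov power2_eq_square)
  also have "\<dots> = (\<Sum>i\<in>N. (\<sigma> $ i)\<^sup>2 * (v $ i)\<^sup>2) * exp (- \<bar>t - s\<bar> / \<tau>)"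
    by (simp add: sum_distrib_right)
  finally show "expectation (\<lambda>w. (v \<bullet> X t w) * (v \<bullet> X s w))
      = (\<Sum>i\<in>N. (\<sigma> $ i)\<^sup>2 * (v $ i)\<^sup>2) * exp (- \<bar>t - s\<bar> / \<tau>)" .
qed

text \<open>After division by \<open>inverse \<tau>\<close>, the remaining difference is continuous
  in \<open>inverse \<tau>\<close> and vanishes at 0, where \<gamma> cancels.\<close>

lemma stationary_response_asymp:
  fixes \<gamma> l S :: real
  assumes "0 < \<gamma>" "0 < l"
  shows "(\<lambda>\<tau>. inverse \<tau> * (\<gamma> * S / ((inverse \<tau>)\<^sup>2 + \<gamma> * inverse \<tau> + \<gamma> * l)) - inverse \<tau> * (S / l))
    \<in> o[at_top](\<lambda>\<tau>. inverse \<tau>)"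
proof (rule smalloI_tendsto)
  have "((\<lambda>\<tau>::real. \<gamma> * S / ((inverse \<tau>)\<^sup>2 + \<gamma> * inverse \<tau> + \<gamma> * l) - S / l) \<longlongrightarrow>
      \<gamma> * S / (0\<^sup>2 + \<gamma> * 0 + \<gamma> * l) - S / l) at_top"
    using assms by (intro tendsto_intros tendsto_inverse_0_at_top filterlim_ident) auto
  also have "\<gamma> * S / (0\<^sup>2 + \<gamma> * 0 + \<gamma> * l) - S / l = 0" using assms by simp
  finally show "((\<lambda>\<tau>. (inverse \<tau> * (\<gamma> * S / ((inverse \<tau>)\<^sup>2 + \<gamma> * inverse \<tau> + \<gamma> * l)) - inverse \<tau> * (S / l)) / inverse \<tau>)
      \<longlongrightarrow> 0) at_top"
    by (rule Lim_transform_eventually)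
      (use eventually_gt_at_top[of 0] in eventually_elim, simp add: field_simps)
  show "\<forall>\<^sub>F \<tau> in at_top. inverse \<tau> \<noteq> (0::real)"
    using eventually_gt_at_top[of 0] by eventually_elim simp
qed

text \<open>Force and frequency are read off by different vectors. Projecting the noise with the
  force mode produces the weight \<open>inverse (d $ i)\<close> in the covariance amplitude.\<close>

lemma (in damped_network) mode_noise_driven_oscillator:
  fixes M :: "'w measure" and \<delta>P \<delta>\<theta> \<omega> :: "real \<Rightarrow> 'w \<Rightarrow> real ^ 'n"
  assumes prob: "prob_space M" and \<tau>: "0 < \<tau>" and \<gamma>: "0 < \<gamma>"
    and inertia: "\<And>i. 0 < m $ i" and ratio: "\<And>i. d $ i / m $ i = \<gamma>"
    and noise: "correlated_noise M N \<sigma> \<tau> \<delta>P"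
    and response: "measurable_process M \<omega>"
    and dynamics: "AE w in M. linearized_swing_solution m d L (\<lambda>t. \<delta>P t w) (\<lambda>t. \<delta>\<theta> t w) (\<lambda>t. \<omega> t w)"
    and \<alpha>: "\<alpha> \<in> {2..CARD('n)}"
  shows "noise_driven_oscillator M (\<lambda>t w. force_mode \<alpha> \<bullet> \<delta>P (max t 0) w)
    (\<lambda>t w. state_mode \<alpha> \<bullet> \<omega> (max t 0) w) \<gamma> (l \<alpha>) (inverse \<tau>)
    (\<Sum>i\<in>N. (\<sigma> $ i)\<^sup>2 * (u \<alpha> $ i)\<^sup>2 * inverse (d $ i))"
proof -
  interpret prob_space M by fact
  have S: "(\<Sum>i\<in>N. (\<sigma> $ i)\<^sup>2 * (u \<alpha> $ i)\<^sup>2 * inverse (d $ i)) = (\<Sum>i\<in>N. (\<sigma> $ i)\<^sup>2 * (force_mode \<alpha> $ i)\<^sup>2)"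
  proof (intro sum.cong refl)
    fix i
    have "(force_mode \<alpha> $ i)\<^sup>2 = (u \<alpha> $ i)\<^sup>2 / d $ i"
      using damping[of i] by (simp add: force_mode_def power_divide)
    then show "(\<sigma> $ i)\<^sup>2 * (u \<alpha> $ i)\<^sup>2 * inverse (d $ i) = (\<sigma> $ i)\<^sup>2 * (force_mode \<alpha> $ i)\<^sup>2"
      by (simp add: divide_inverse)
  qed
  have noiseP: "measurable_process M \<delta>P" using noise by (simp add: correlated_noise_def)
  have proj: "case_prod (\<lambda>t w. v \<bullet> X (max t 0) w) \<in> borel_measurable (borel \<Otimes>\<^sub>M M)"
    if "measurable_process M X" for v :: "real ^ 'n" and X
    using borel_measurable_inner[OF borel_measurable_const measurable_process_extend[OF that], of v]
    by (simp add: split_beta')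
  have \<alpha>1: "\<alpha> \<in> {1..CARD('n)}" using \<alpha> by auto
  show ?thesis
  proof
    show "0 < \<gamma>" "0 < inverse \<tau>" "0 < l \<alpha>" using \<gamma> \<tau> eigenvalue_pos[OF \<alpha>] by simp_all
    show "case_prod (\<lambda>t w. force_mode \<alpha> \<bullet> \<delta>P (max t 0) w) \<in> borel_measurable (borel \<Otimes>\<^sub>M M)"
      by (rule proj[OF noiseP])
    show "case_prod (\<lambda>t w. state_mode \<alpha> \<bullet> \<omega> (max t 0) w) \<in> borel_measurable (borel \<Otimes>\<^sub>M M)"
      by (rule proj[OF response])
    show "integrable M (\<lambda>w. (force_mode \<alpha> \<bullet> \<delta>P (max t 0) w)\<^sup>2)" if "0 \<le> t" for t
      using correlated_noise_moments(1)[OF noise that that, of "force_mode \<alpha>"] that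
      by (simp add: power2_eq_square)
    show "expectation (\<lambda>w. (force_mode \<alpha> \<bullet> \<delta>P (max t 0) w) * (force_mode \<alpha> \<bullet> \<delta>P (max s 0) w))
        = (\<Sum>i\<in>N. (\<sigma> $ i)\<^sup>2 * (u \<alpha> $ i)\<^sup>2 * inverse (d $ i)) * exp (- inverse \<tau> * \<bar>t - s\<bar>)"
      if "0 \<le> t" "0 \<le> s" for t s
      using correlated_noise_moments(2)[OF noise that, of "force_mode \<alpha>"] that
      unfolding S by (simp add: divide_inverse mult.commute)
    show "AE w in M. \<exists>c. c 0 = 0 \<and> state_mode \<alpha> \<bullet> \<omega> (max 0 0) w = 0 \<and> (\<forall>t\<ge>0.
      (c has_real_derivative state_mode \<alpha> \<bullet> \<omega> (max t 0) w) (at t within {0..}) \<and>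
      ((\<lambda>t. state_mode \<alpha> \<bullet> \<omega> (max t 0) w) has_real_derivative
        \<gamma> * (force_mode \<alpha> \<bullet> \<delta>P (max t 0) w) - \<gamma> * (state_mode \<alpha> \<bullet> \<omega> (max t 0) w) - \<gamma> * l \<alpha> * c t) (at t within {0..}))"
      using dynamics
    proof eventually_elim
      fix w assume w: "linearized_swing_solution m d L (\<lambda>t. \<delta>P t w) (\<lambda>t. \<delta>\<theta> t w) (\<lambda>t. \<omega> t w)"
      have z: "((\<lambda>t. state_mode \<alpha> \<bullet> \<omega> (max t 0) w) has_real_derivative D) (at t within {0..})"
        if "((\<lambda>t. state_mode \<alpha> \<bullet> \<omega> t w) has_real_derivative D) (at t within {0..})" "0 \<le> t" for t D
        using that(1) unfolding has_field_derivative_def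
        by (rule has_derivative_transform[rotated 2]) (use that(2) in auto)
      note mode = mode_equation[OF ratio inertia w \<alpha>1]
      show "\<exists>c. c 0 = 0 \<and> state_mode \<alpha> \<bullet> \<omega> (max 0 0) w = 0 \<and> (\<forall>t\<ge>0.
        (c has_real_derivative state_mode \<alpha> \<bullet> \<omega> (max t 0) w) (at t within {0..}) \<and>
        ((\<lambda>t. state_mode \<alpha> \<bullet> \<omega> (max t 0) w) has_real_derivative
          \<gamma> * (force_mode \<alpha> \<bullet> \<delta>P (max t 0) w) - \<gamma> * (state_mode \<alpha> \<bullet> \<omega> (max t 0) w) - \<gamma> * l \<alpha> * c t) (at t within {0..}))"
      proof (intro exI[of _ "\<lambda>t. state_mode \<alpha> \<bullet> \<delta>\<theta> t w"] conjI allI impI)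
        show "state_mode \<alpha> \<bullet> \<delta>\<theta> 0 w = 0" "state_mode \<alpha> \<bullet> \<omega> (max 0 0) w = 0"
          using w by (simp_all add: linearized_swing_solution_def)
        fix t :: real assume t: "0 \<le> t"
        show "((\<lambda>t. state_mode \<alpha> \<bullet> \<delta>\<theta> t w) has_real_derivative state_mode \<alpha> \<bullet> \<omega> (max t 0) w) (at t within {0..})"
          using mode(1)[OF t] t by simp
        show "((\<lambda>t. state_mode \<alpha> \<bullet> \<omega> (max t 0) w) has_real_derivative
          \<gamma> * (force_mode \<alpha> \<bullet> \<delta>P (max t 0) w) - \<gamma> * (state_mode \<alpha> \<bullet> \<omega> (max t 0) w)
          - \<gamma> * l \<alpha> * (state_mode \<alpha> \<bullet> \<delta>\<theta> t w)) (at t within {0..})"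
          using z[OF mode(2)[OF t] t] t by simp
      qed
    qed
  qed
qed

text \<open>The modal forces may be correlated with each other, but the effort is a sum of squares
  over modes, so the single-mode limits simply add.\<close>

lemma (in damped_network) control_effort_limit:
  fixes M :: "'w measure" and \<delta>P \<delta>\<theta> \<omega> :: "real \<Rightarrow> 'w \<Rightarrow> real ^ 'n"
  assumes prob: "prob_space M" and \<tau>: "0 < \<tau>" and \<gamma>: "0 < \<gamma>"
    and inertia: "\<And>i. 0 < m $ i" and ratio: "\<And>i. d $ i / m $ i = \<gamma>"
    and noise: "correlated_noise M N \<sigma> \<tau> \<delta>P"
    and response: "measurable_process M \<omega>"
    and dynamics: "AE w in M. linearized_swing_solution m d L (\<lambda>t. \<delta>P t w) (\<lambda>t. \<delta>\<theta> t w) (\<lambda>t. \<omega> t w)"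
  shows "integrable M (\<lambda>w. control_effort d (\<lambda>t. \<omega> t w) T)"
    and "((\<lambda>T. mean_control_effort M d \<omega> T) \<longlongrightarrow>
      (\<Sum>\<alpha>=2..CARD('n). inverse \<tau> * (\<gamma> * (\<Sum>i\<in>N. (\<sigma> $ i)\<^sup>2 * (u \<alpha> $ i)\<^sup>2 * inverse (d $ i))
        / ((inverse \<tau>)\<^sup>2 + \<gamma> * inverse \<tau> + \<gamma> * l \<alpha>)))) at_top"
proof -
  interpret prob_space M by fact
  let ?z = "\<lambda>\<alpha> t w. state_mode \<alpha> \<bullet> \<omega> (max t 0) w"
  let ?I = "\<lambda>T \<alpha> w. LBINT t:{0..T}. (?z \<alpha> t w)\<^sup>2"
  note mode = mode_noise_driven_oscillator[OF assms]
  have meas: "(\<lambda>w. control_effort d (\<lambda>t. \<omega> t w) T) \<in> borel_measurable M"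
    and AE_eq: "AE w in M. control_effort d (\<lambda>t. \<omega> t w) T = 1 / T * (\<Sum>\<alpha>=2..CARD('n). ?I T \<alpha> w)" for T
  proof -
    have ce: "control_effort d (\<lambda>t. \<omega> t w) T
        = 1 / T * (\<integral>t. indicator {0..T} t * (\<Sum>\<alpha>=2..CARD('n). (?z \<alpha> t w)\<^sup>2) \<partial>lborel)" for w
      unfolding control_effort_def effort_modes set_lebesgue_integral_def
      by (intro arg_cong2[where f = "(*)"] Bochner_Integration.integral_cong) (auto simp: indicator_def)
    have z: "(\<lambda>(w, t). ?z \<alpha> t w) \<in> borel_measurable (M \<Otimes>\<^sub>M lborel)" if "\<alpha> \<in> {2..CARD('n)}" for \<alpha>
    proof -
      have [measurable]: "case_prod (?z \<alpha>) \<in> borel_measurable (borel \<Otimes>\<^sub>M M)"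
        by (rule noise_driven_oscillator.z_measurable[OF mode[OF that]])
      show ?thesis by measurable
    qed
    \<comment> \<open>The split into modes holds only almost everywhere, so measurability of the
      effort itself is proved from the unsplit integrand.\<close>
    have "(\<lambda>(w, t). indicator {0..T} t * (\<Sum>\<alpha>=2..CARD('n). (?z \<alpha> t w)\<^sup>2)) \<in> borel_measurable (M \<Otimes>\<^sub>M lborel)"
      using z by (auto simp: split_beta' intro!: borel_measurable_times borel_measurable_sum borel_measurable_power)
    then have "(\<lambda>w. \<integral>t. indicator {0..T} t * (\<Sum>\<alpha>=2..CARD('n). (?z \<alpha> t w)\<^sup>2) \<partial>lborel) \<in> borel_measurable M"
      by (rule lborel.borel_measurable_lebesgue_integral)
    then show "(\<lambda>w. control_effort d (\<lambda>t. \<omega> t w) T) \<in> borel_measurable M"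
      unfolding ce by (rule borel_measurable_times[OF borel_measurable_const])
    \<comment> \<open>One null set serves all of the finitely many modes; outside it the time
      integral can be exchanged with the sum.\<close>
    have "AE w in M. \<forall>\<alpha>\<in>{2..CARD('n)}. set_integrable lborel {0..T} (\<lambda>t. (?z \<alpha> t w)\<^sup>2)"
      by (intro AE_finite_allI noise_driven_oscillator.AE_kinetic_set_integrable[OF mode]) auto
    then show "AE w in M. control_effort d (\<lambda>t. \<omega> t w) T = 1 / T * (\<Sum>\<alpha>=2..CARD('n). ?I T \<alpha> w)"
    proof eventually_elim
      fix w assume w: "\<forall>\<alpha>\<in>{2..CARD('n)}. set_integrable lborel {0..T} (\<lambda>t. (?z \<alpha> t w)\<^sup>2)"
      have "(\<integral>t. indicator {0..T} t * (\<Sum>\<alpha>=2..CARD('n). (?z \<alpha> t w)\<^sup>2) \<partial>lborel)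
          = (\<integral>t. (\<Sum>\<alpha>=2..CARD('n). indicator {0..T} t * (?z \<alpha> t w)\<^sup>2) \<partial>lborel)"
        by (simp only: sum_distrib_left)
      also have "\<dots> = (\<Sum>\<alpha>=2..CARD('n). \<integral>t. indicator {0..T} t * (?z \<alpha> t w)\<^sup>2 \<partial>lborel)"
        using w by (intro Bochner_Integration.integral_sum) (simp add: set_integrable_def)
      finally show "control_effort d (\<lambda>t. \<omega> t w) T = 1 / T * (\<Sum>\<alpha>=2..CARD('n). ?I T \<alpha> w)"
        unfolding ce set_lebesgue_integral_def real_scaleR_def by (simp only:)
    qed
  qed
  have int: "integrable M (?I T \<alpha>)" if "\<alpha> \<in> {2..CARD('n)}" for T \<alpha>
    by (rule noise_driven_oscillator.kinetic_integrable[OF mode[OF that]])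
  then have "integrable M (\<lambda>w. 1 / T * (\<Sum>\<alpha>=2..CARD('n). ?I T \<alpha> w))" for T
    by (intro integrable_mult_right Bochner_Integration.integrable_sum)
  then show "integrable M (\<lambda>w. control_effort d (\<lambda>t. \<omega> t w) T)"
    using integrable_cong_AE[OF meas borel_measurable_integrable AE_eq] by blast
  have mean: "mean_control_effort M d \<omega> T = (\<Sum>\<alpha>=2..CARD('n). 1 / T * expectation (?I T \<alpha>))" for T
  proof -
    have "mean_control_effort M d \<omega> T = expectation (\<lambda>w. 1 / T * (\<Sum>\<alpha>=2..CARD('n). ?I T \<alpha> w))"
      unfolding mean_control_effort_def
      using int by (intro integral_cong_AE meas AE_eq borel_measurable_times borel_measurable_sum borel_measurable_const borel_measurable_integrable)
    also have "\<dots> = 1 / T * expectation (\<lambda>w. \<Sum>\<alpha>=2..CARD('n). ?I T \<alpha> w)" by simp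
    also have "expectation (\<lambda>w. \<Sum>\<alpha>=2..CARD('n). ?I T \<alpha> w) = (\<Sum>\<alpha>=2..CARD('n). expectation (?I T \<alpha>))"
      using int by (rule Bochner_Integration.integral_sum)
    finally show ?thesis by (simp only: sum_distrib_left)
  qed
  show "((\<lambda>T. mean_control_effort M d \<omega> T) \<longlongrightarrow>
      (\<Sum>\<alpha>=2..CARD('n). inverse \<tau> * (\<gamma> * (\<Sum>i\<in>N. (\<sigma> $ i)\<^sup>2 * (u \<alpha> $ i)\<^sup>2 * inverse (d $ i))
        / ((inverse \<tau>)\<^sup>2 + \<gamma> * inverse \<tau> + \<gamma> * l \<alpha>)))) at_top"
    unfolding mean
  proof (rule tendsto_sum)
    fix \<alpha> assume \<alpha>: "\<alpha> \<in> {2..CARD('n)}"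
    show "((\<lambda>T. 1 / T * expectation (?I T \<alpha>)) \<longlongrightarrow>
      inverse \<tau> * (\<gamma> * (\<Sum>i\<in>N. (\<sigma> $ i)\<^sup>2 * (u \<alpha> $ i)\<^sup>2 * inverse (d $ i))
        / ((inverse \<tau>)\<^sup>2 + \<gamma> * inverse \<tau> + \<gamma> * l \<alpha>))) at_top"
      using noise_driven_oscillator.mean_kinetic_tendsto[OF mode[OF \<alpha>]]
      unfolding noise_driven_oscillator.stationary_response_def[OF mode[OF \<alpha>]] .
  qed
qed

text \<open>Bochner integrals and \<open>Lim\<close> are total operators. Integrability and
  convergence are therefore claimed along with the asymptotics, so that the averaged effort and its
  limit have their genuine meaning.\<close>

theorem corollary2:
  fixes b L :: "real ^ 'n ^ 'n" and m d P \<theta>0 \<delta>P0 :: "real ^ 'n" and \<gamma> :: real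
    and N :: "'n set"
    and u :: "nat \<Rightarrow> real ^ 'n" and l :: "nat \<Rightarrow> real"
    and M :: "real \<Rightarrow> 'w measure"
    and \<delta>P \<delta>\<theta> \<omega> :: "real \<Rightarrow> real \<Rightarrow> 'w \<Rightarrow> real ^ 'n"
  assumes susceptances: "\<And>i j. b $ i $ j = b $ j $ i" "\<And>i j. 0 \<le> b $ i $ j"
    and inertia: "\<And>i. 0 < m $ i"
    and damping: "\<And>i. 0 < d $ i"
    and synchronous: "synchronous_state b m d P \<theta>0"
    and laplacian: "L = weighted_laplacian b \<theta>0"
    and stable: "stable_laplacian L"
    and eigenbasis: "orthonormal_eigenbasis (damped_laplacian d L) u l" "l 1 = 0"
    and ratio: "0 < \<gamma>" "\<And>i. d $ i / m $ i = \<gamma>"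
    and prob: "\<And>\<tau>. 0 < \<tau> \<Longrightarrow> prob_space (M \<tau>)"
    and noise: "\<And>\<tau>. 0 < \<tau> \<Longrightarrow> correlated_noise (M \<tau>) N \<delta>P0 \<tau> (\<delta>P \<tau>)"
    and response: "\<And>\<tau>. 0 < \<tau> \<Longrightarrow> measurable_process (M \<tau>) (\<omega> \<tau>)"
    and dynamics: "\<And>\<tau>. 0 < \<tau> \<Longrightarrow> AE w in M \<tau>.
      linearized_swing_solution m d L (\<lambda>t. \<delta>P \<tau> t w) (\<lambda>t. \<delta>\<theta> \<tau> t w) (\<lambda>t. \<omega> \<tau> t w)"
  shows "(\<forall>\<tau>>0. \<forall>T>0. integrable (M \<tau>) (\<lambda>w. control_effort d (\<lambda>t. \<omega> \<tau> t w) T)) \<and>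
    (\<forall>\<tau>>0. ((\<lambda>T. mean_control_effort (M \<tau>) d (\<omega> \<tau>) T)
        \<longlongrightarrow> mean_control_effort_inf (M \<tau>) d (\<omega> \<tau>)) at_top) \<and>
    (\<lambda>\<tau>. mean_control_effort_inf (M \<tau>) d (\<omega> \<tau>) -
          inverse \<tau> * (\<Sum>\<alpha>=2..CARD('n).
            (\<Sum>i\<in>N. (\<delta>P0 $ i)\<^sup>2 * (u \<alpha> $ i)\<^sup>2 * inverse (d $ i)) / l \<alpha>))
      \<in> o[at_top](\<lambda>\<tau>. inverse \<tau>)"
proof -
  interpret damped_network d L u l
    using damping stable eigenbasis by unfold_locales
  define S where "S \<alpha> = (\<Sum>i\<in>N. (\<delta>P0 $ i)\<^sup>2 * (u \<alpha> $ i)\<^sup>2 * inverse (d $ i))" for \<alpha>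
  \<comment> \<open>The exact limit at each correlation time; the asymptotics in \<tau> is applied
    to this closed form.\<close>
  define Q where "Q \<tau> = (\<Sum>\<alpha>=2..CARD('n). inverse \<tau> * (\<gamma> * S \<alpha>
      / ((inverse \<tau>)\<^sup>2 + \<gamma> * inverse \<tau> + \<gamma> * l \<alpha>)))" for \<tau>
  have int: "integrable (M \<tau>) (\<lambda>w. control_effort d (\<lambda>t. \<omega> \<tau> t w) T)"
    and lim: "((\<lambda>T. mean_control_effort (M \<tau>) d (\<omega> \<tau>) T) \<longlongrightarrow> Q \<tau>) at_top" if "0 < \<tau>" for \<tau> T
    using control_effort_limit[OF prob[OF that] that ratio(1) inertia ratio(2) noise[OF that]
        response[OF that] dynamics[OF that]]
    by (simp_all only: Q_def S_def)
  have inf: "mean_control_effort_inf (M \<tau>) d (\<omega> \<tau>) = Q \<tau>" if "0 < \<tau>" for \<tau>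
    unfolding mean_control_effort_inf_def by (rule tendsto_Lim[OF _ lim[OF that]]) simp
  have "(\<lambda>\<tau>. \<Sum>\<alpha>=2..CARD('n). inverse \<tau> * (\<gamma> * S \<alpha> / ((inverse \<tau>)\<^sup>2 + \<gamma> * inverse \<tau> + \<gamma> * l \<alpha>))
      - inverse \<tau> * (S \<alpha> / l \<alpha>)) \<in> o[at_top](\<lambda>\<tau>. inverse \<tau>)"
    using ratio(1) eigenvalue_pos by (intro big_sum_in_smallo stationary_response_asymp)
  then have small: "(\<lambda>\<tau>. Q \<tau> - inverse \<tau> * (\<Sum>\<alpha>=2..CARD('n). S \<alpha> / l \<alpha>)) \<in> o[at_top](\<lambda>\<tau>. inverse \<tau>)"
    by (simp add: Q_def sum_subtractf sum_distrib_left)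
  \<comment> \<open>The limit is identified for positive \<tau>, and small-o at
    \<open>at_top\<close> depends only on large values.\<close>
  have "\<forall>\<^sub>F \<tau> in at_top. Q \<tau> - inverse \<tau> * (\<Sum>\<alpha>=2..CARD('n). S \<alpha> / l \<alpha>)
      = mean_control_effort_inf (M \<tau>) d (\<omega> \<tau>) - inverse \<tau> * (\<Sum>\<alpha>=2..CARD('n). S \<alpha> / l \<alpha>)"
    using eventually_gt_at_top[of 0] by eventually_elim (simp add: inf)
  from landau_o.small.in_cong[OF this] small
  have "(\<lambda>\<tau>. mean_control_effort_inf (M \<tau>) d (\<omega> \<tau>) - inverse \<tau> * (\<Sum>\<alpha>=2..CARD('n). S \<alpha> / l \<alpha>))
      \<in> o[at_top](\<lambda>\<tau>. inverse \<tau>)"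
    by (rule iffD1)
  then show ?thesis
    using int lim unfolding S_def by (auto simp only: inf)
qed

end
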